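(* Assume $$\lim_{n\to\infty}\rho_n=0,\qquad \lim_{n\to\infty}\frac{\gamma_n}{\rho_n}=0,\qquad \sum_n\rho_n\gamma_n=\infty,\qquad \rho_n-\rho_{n-1}=o(\rho_n\gamma_n).$$ Then the sequence $\left((1-X_n)/\rho_n\right)_{n\ge1}$ converges to $(1-p_A)/\pi$ in probability.
   Context: Let $0<p_B<p_A<1$ and $\pi=p_A-p_B$. Let $(\gamma_n)_{n\ge 1}$ be a non-increasing sequence of positive numbers with $\gamma_n<1$, $\sum_{n\ge 1}\gamma_n=+\infty$ and $\sum_{n}e^{-\vartheta/\gamma_n}<\infty$ for every $\vartheta>0$. Let $(\rho_n)_{n\ge 1}$ be a sequence of positive numbers with $\gamma_n\rho_n<1$. Let $(U_n)_{n\ge 1}$ be i.i.d. random variables uniformly distributed on $[0,1]$, and let $A_n,B_n$ ($n\ge1$) be events with $\mathbb{P}(A_n)=p_A$, $\mathbb{P}(B_n)=p_B$, such that the pairs $(\mathbf 1_{A_n},\mathbf 1_{B_n})$, $n\ge 1$, are independent of one another and the sequence $(\mathbf 1_{A_n},\mathbf 1_{B_n})_{n\ge1}$ is independent of $(U_n)_{n\ge1}$. The penalized two-armed bandit algorithm is the $[0,1]$-valued sequence $(X_n)_{n\ge0}$ with $X_0=x\in(0,1)$ and $$X_{n+1}=X_n+\gamma_{n+1}\left(\mathbf 1_{\{U_{n+1}\le X_n\}\cap A_{n+1}}(1-X_n)-\mathbf 1_{\{U_{n+1}>X_n\}\cap B_{n+1}}X_n\right)-\gamma_{n+1}\rho_{n+1}\left(X_n\mathbf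 1_{\{U_{n+1}\le X_n\}\cap A_{n+1}^c}-(1-X_n)\mathbf 1_{\{U_{n+1}>X_n\}\cap B_{n+1}^c}\right),\quad n\ge0.$$ *)

theory Defs
  imports "HOL-Probability.Probability" "HOL-Library.Landau_Symbols"
begin

text \<open>
  All step sequences, random variables and events of the algorithm are indexed by \<open>n \<ge> 1\<close>;
  their values at index \<open>0\<close> are unconstrained and never used by the recursion.
\<close>

primrec bandit ::
  "(nat \<Rightarrow> real) \<Rightarrow> (nat \<Rightarrow> real) \<Rightarrow> (nat \<Rightarrow> 'a \<Rightarrow> real) \<Rightarrow> (nat \<Rightarrow> 'a set) \<Rightarrow> (nat \<Rightarrow> 'a set) \<Rightarrow> real
    \<Rightarrow> nat \<Rightarrow> 'a \<Rightarrow> real" where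
  "bandit \<gamma> \<rho> U A B x 0 = (\<lambda>\<omega>. x)"
| "bandit \<gamma> \<rho> U A B x (Suc n) =
    (let X = bandit \<gamma> \<rho> U A B x n in
     (\<lambda>\<omega>. X \<omega>
       + \<gamma> (Suc n) *
           (indicator ({\<omega>. U (Suc n) \<omega> \<le> X \<omega>} \<inter> A (Suc n)) \<omega> * (1 - X \<omega>)
            - indicator ({\<omega>. U (Suc n) \<omega> > X \<omega>} \<inter> B (Suc n)) \<omega> * X \<omega>)
       - \<gamma> (Suc n) * \<rho> (Suc n) *
           (X \<omega> * indicator ({\<omega>. U (Suc n) \<omega> \<le> X \<omega>} \<inter> - A (Suc n)) \<omega>
            - (1 - X \<omega>) * indicator ({\<omega>. U (Suc n) \<omega> > X \<omega>} \<inter> - B (Suc n)) \<omega>)))"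

text \<open>
  Independence of two random elements that may take values in different types, which
  \<^const>\<open>prob_space.indep_var\<close> does not allow.
\<close>

definition (in prob_space) indep_rv ::
  "'b measure \<Rightarrow> ('a \<Rightarrow> 'b) \<Rightarrow> 'c measure \<Rightarrow> ('a \<Rightarrow> 'c) \<Rightarrow> bool" where
  "indep_rv M1 X M2 Y \<longleftrightarrow>
     random_variable M1 X \<and> random_variable M2 Y \<and>
     indep_set {X -` S \<inter> space M | S. S \<in> sets M1} {Y -` S \<inter> space M | S. S \<in> sets M2}"

locale penalized_bandit = prob_space M
  for M :: "'a measure" +
  fixes p_A p_B :: real
    and \<gamma> \<rho> :: "nat \<Rightarrow> real"
    and U :: "nat \<Rightarrow> 'a \<Rightarrow> real"
    and A B :: "nat \<Rightarrow> 'a set"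
    and x :: real
  assumes p_B_pos: "0 < p_B"
    and p_B_less_p_A: "p_B < p_A"
    and p_A_less_1: "p_A < 1"
    and \<gamma>_pos: "n \<ge> 1 \<Longrightarrow> 0 < \<gamma> n"
    and \<gamma>_less_1: "n \<ge> 1 \<Longrightarrow> \<gamma> n < 1"
    and \<gamma>_antimono: "antimono_on {1..} \<gamma>"
    and \<gamma>_sum: "filterlim (\<lambda>N. \<Sum>n=1..N. \<gamma> n) at_top sequentially"
    and \<gamma>_exp_summable: "\<theta> > 0 \<Longrightarrow> summable (\<lambda>n. exp (- \<theta> / \<gamma> (Suc n)))"
    and \<rho>_pos: "n \<ge> 1 \<Longrightarrow> 0 < \<rho> n"
    and \<gamma>_\<rho>_less_1: "n \<ge> 1 \<Longrightarrow> \<gamma> n * \<rho> n < 1"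
    and U_indep: "indep_vars (\<lambda>_. borel) U {1..}"
    and U_uniform: "n \<ge> 1 \<Longrightarrow> distr M borel (U n) = uniform_measure lborel {0..1}"
    and A_event: "n \<ge> 1 \<Longrightarrow> A n \<in> events"
    and B_event: "n \<ge> 1 \<Longrightarrow> B n \<in> events"
    and prob_A: "n \<ge> 1 \<Longrightarrow> prob (A n) = p_A"
    and prob_B: "n \<ge> 1 \<Longrightarrow> prob (B n) = p_B"
    and AB_indep:
      "indep_vars (\<lambda>_. borel \<Otimes>\<^sub>M borel)
         (\<lambda>n \<omega>. (indicator (A n) \<omega> :: real, indicator (B n) \<omega> :: real)) {1..}"
    and AB_U_indep:
      "indep_rv
         (PiM {1..} (\<lambda>_. borel \<Otimes>\<^sub>M borel))
         (\<lambda>\<omega>. \<lambda>n\<in>{1..}. (indicator (A n) \<omega> :: real, indicator (B n) \<omega> :: real))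
         (PiM {1..} (\<lambda>_. borel))
         (\<lambda>\<omega>. \<lambda>n\<in>{1..}. U n \<omega>)"
    and x_pos: "0 < x"
    and x_less_1: "x < 1"

text \<open>
  Measurability is part of the definition because \<^const>\<open>measure\<close> is \<open>0\<close> on non-measurable sets.
\<close>

definition converges_in_probability ::
  "'a measure \<Rightarrow> (nat \<Rightarrow> 'a \<Rightarrow> real) \<Rightarrow> ('a \<Rightarrow> real) \<Rightarrow> bool" where
  "converges_in_probability M Y Z \<longleftrightarrow>
     (\<forall>n. Y n \<in> borel_measurable M) \<and> Z \<in> borel_measurable M \<and>
     (\<forall>\<epsilon>>0. (\<lambda>n. measure M {\<omega> \<in> space M. \<bar>Y n \<omega> - Z \<omega>\<bar> > \<epsilon>}) \<longlonglongrightarrow> 0)"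

end

theory Submission
  imports Defs
begin

text \<open>
  Write \<open>\<pi> = p_A - p_B\<close>, \<open>c = (1 - p_A) / \<pi>\<close> and \<open>Y n = (1 - X n) / \<rho> n\<close>. The proof gives convergence of
  \<open>Y n\<close> to \<open>c\<close> in mean square and ends with Chebyshev's inequality. Expanding the square, it is
  enough that asymptotically \<open>E (Y n)\<^sup>2\<close> is at most \<open>c\<^sup>2\<close> and \<open>E (Y n)\<close> is at least \<open>c\<close>, because then
  \<open>E (Y n - c)\<^sup>2\<close> is asymptotically at most \<open>c\<^sup>2 - 2 c\<^sup>2 + c\<^sup>2 = 0\<close>.

  The conditional mean of a step, divided by \<open>\<gamma>\<close>, is
  \<open>\<pi> X (1 - X) - \<rho> ((1 - p_A) X\<^sup>2 - (1 - p_B) (1 - X)\<^sup>2)\<close>. Dropping the quadratic terms in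
  \<open>1 - X\<close> can only lower the mean of the next \<open>1 - X\<close> up to a relative error of order \<open>\<gamma> \<rho>\<close>, and this
  gives the lower bound on \<open>E (Y n)\<close> (\<open>mean_ratio_Suc_ge\<close>).

  The upper bound is harder, because \<open>1 - X\<close> does not contract near the repelling point \<open>X = 0\<close>,
  where only the penalty pushes the process away. The remedy is to replace \<open>1 - X\<close> by the odds
  \<open>f = (1 - X) / (X + \<rho>)\<close>: for the differential equation \<open>X' = \<pi> X (1 - X)\<close> the ratio
  \<open>(1 - X) / X\<close> decays at the constant rate \<open>\<pi>\<close> on all of the interval, and the added
  \<open>\<rho>\<close> both keeps the ratio finite and lets the penalty provide the contraction near 0. The drift of
  \<open>f\<close> is at most \<open>- \<pi> f + \<rho> (1 - p_A)\<close> up to factors tending to 1, and the fluctuations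
  contribute to \<open>f\<^sup>2\<close> only a multiple of \<open>\<gamma> (\<gamma> / \<rho>) (f\<^sup>2 + \<rho>\<^sup>2)\<close>, where \<open>\<gamma> / \<rho>\<close> vanishes
  (\<open>transition_square_odds_le\<close>). As \<open>2 f c \<rho> \<le> f\<^sup>2 + c\<^sup>2 \<rho>\<^sup>2\<close>, the second moment
  \<open>w n = E f\<^sup>2 / \<rho>\<^sup>2\<close> satisfies \<open>w (n + 1) \<le> (1 - \<pi> \<gamma>) w n + \<pi> c\<^sup>2 \<gamma>\<close> up to \<open>o(\<gamma>)\<close>; the slow
  variation of \<open>\<rho>\<close> makes the change of normalisation from \<open>\<rho> n\<close> to \<open>\<rho> (n + 1)\<close> part of this error
  (\<open>odds_moment_Suc_le\<close>). Since the sum of the \<open>\<gamma> n\<close> diverges, such recursions forget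
  their initial value (\<open>limsup_le_of_contraction\<close>). The bound on
  \<open>w\<close> already contains the convergence of \<open>X n\<close> to 1.

  The passage from the random recursion to these deterministic ones is
  \<open>expectation_transition\<close>: \<open>E H(X (n + 1)) = E (Q H)(X n)\<close> for an explicit averaging operator
  \<open>Q\<close>, which uses that \<open>X n\<close>, \<open>U (n + 1)\<close> and the pair of events at time \<open>n + 1\<close> are independent.
\<close>

section \<open>Recursions with a divergent sum of step sizes\<close>

text \<open>
  Centred at its fixed point \<open>b / a\<close>, the recursion is multiplication by \<open>1 - a g \<le> exp (- a g)\<close>, so
  the distance above \<open>b / a\<close> is at most a constant times \<open>exp\<close> of \<open>- a\<close> times the sum of the steps.
\<close>

lemma limsup_le_of_contraction:
  fixes u g :: "nat \<Rightarrow> real"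
  assumes a: "a > 0"
    and g_lim: "g \<longlonglongrightarrow> 0"
    and g_sum: "filterlim (\<lambda>N. \<Sum>n=1..N. g n) at_top sequentially"
    and step: "\<forall>\<^sub>F n in sequentially. u (Suc n) \<le> (1 - a * g (Suc n)) * u n + b * g (Suc n)"
    and \<epsilon>: "\<epsilon> > 0"
  shows "\<forall>\<^sub>F n in sequentially. u n \<le> b / a + \<epsilon>"
proof -
  have "(\<lambda>n. a * g (Suc n)) \<longlonglongrightarrow> a * 0"
    by (intro tendsto_intros LIMSEQ_Suc g_lim)
  then have "\<forall>\<^sub>F n in sequentially. a * g (Suc n) < 1"
    by (rule order_tendstoD) simp
  with step obtain N where
    N: "\<And>n. n \<ge> N \<Longrightarrow> u (Suc n) \<le> (1 - a * g (Suc n)) * u n + b * g (Suc n)"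
       "\<And>n. n \<ge> N \<Longrightarrow> a * g (Suc n) < 1"
    by (metis (mono_tags, lifting) eventually_conj eventually_sequentially)
  define S where "S n = (\<Sum>k=1..n. g k)" for n
  define C where "C = max 0 (u N - b / a)"
  have affine: "(1 - k) * v + k * m - m = (1 - k) * (v - m)" for k v m :: real
    by (simp add: algebra_simps)
  have bound: "u n - b / a \<le> C * exp (- a * (S n - S N))" if "n \<ge> N" for n
    using that
  proof (induction n rule: dec_induct)
    case base
    show ?case by (simp add: C_def)
  next
    case (step n)
    have "u (Suc n) - b / a \<le> (1 - a * g (Suc n)) * u n + (a * g (Suc n)) * (b / a) - b / a"
      using N(1)[of n] step a by (simp add: mult.commute)
    also have "\<dots> = (1 - a * g (Suc n)) * (u n - b / a)"
      by (rule affine)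
    finally have "u (Suc n) - b / a \<le> (1 - a * g (Suc n)) * (u n - b / a)" .
    also have "\<dots> \<le> (1 - a * g (Suc n)) * (C * exp (- a * (S n - S N)))"
      using step N(2)[of n] by (intro mult_left_mono) auto
    also have "\<dots> \<le> exp (- a * g (Suc n)) * (C * exp (- a * (S n - S N)))"
      using exp_ge_add_one_self[of "- a * g (Suc n)"] by (intro mult_right_mono) (auto simp: C_def)
    also have "\<dots> = C * exp (- a * (S (Suc n) - S N))"
      by (simp add: S_def algebra_simps flip: exp_add)
    finally show ?case .
  qed
  have "filterlim (\<lambda>n. a * (- S N + S n)) at_top sequentially"
    using a g_sum unfolding S_def
    by (intro filterlim_tendsto_pos_mult_at_top[OF tendsto_const]
        filterlim_tendsto_add_at_top[OF tendsto_const])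
  then have "(\<lambda>n. C * exp (- (a * (- S N + S n)))) \<longlonglongrightarrow> C * 0"
    by (intro tendsto_intros filterlim_compose[OF exp_at_bot]) (simp add: filterlim_uminus_at_top)
  then have "\<forall>\<^sub>F n in sequentially. C * exp (- (a * (- S N + S n))) < \<epsilon>"
    using \<epsilon> by (intro order_tendstoD) auto
  then show ?thesis
    using eventually_ge_at_top[of N]
  proof eventually_elim
    case (elim n)
    with bound[of n] show ?case by (simp add: algebra_simps)
  qed
qed

section \<open>Independence of two merged families\<close>

text \<open>
  Two independent families, each consisting of independent members, form one independent family
  over the disjoint union of the index sets. Stated for families of sets of events, this allows the
  two families of random variables to take values in different types.
\<close>

lemma (in prob_space) indep_sets_sum:
  assumes F: "indep_sets F I" and G: "indep_sets G J"
    and FG: "\<And>K L a b. finite K \<Longrightarrow> K \<noteq> {} \<Longrightarrow> K \<subseteq> I \<Longrightarrow> finite L \<Longrightarrow> L \<noteq> {} \<Longrightarrow> L \<subseteq> J \<Longrightarrow>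
      (\<And>i. i \<in> K \<Longrightarrow> a i \<in> F i) \<Longrightarrow> (\<And>j. j \<in> L \<Longrightarrow> b j \<in> G j) \<Longrightarrow>
      prob ((\<Inter>i\<in>K. a i) \<inter> (\<Inter>j\<in>L. b j)) = prob (\<Inter>i\<in>K. a i) * prob (\<Inter>j\<in>L. b j)"
  shows "indep_sets (case_sum F G) (I <+> J)"
proof (rule indep_setsI)
  show "case_sum F G k \<subseteq> events" if "k \<in> I <+> J" for k
    using that F G by (auto simp: indep_sets_def split: sum.split)
next
  fix N and c :: "'b + 'c \<Rightarrow> 'a set"
  assume N: "N \<noteq> {}" "N \<subseteq> I <+> J" "finite N" and c: "\<forall>k\<in>N. c k \<in> case_sum F G k"
  define K where "K = Inl -` N"
  define L where "L = Inr -` N"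
  have N_eq: "N = Inl ` K \<union> Inr ` L"
  proof (rule set_eqI)
    show "k \<in> N \<longleftrightarrow> k \<in> Inl ` K \<union> Inr ` L" for k
      by (cases k) (auto simp: K_def L_def)
  qed
  have KL: "finite K" "finite L" "K \<subseteq> I" "L \<subseteq> J"
    using N by (auto simp: K_def L_def intro!: finite_vimageI)
  have cK: "c (Inl i) \<in> F i" if "i \<in> K" for i
    using c that by (force simp: N_eq)
  have cL: "c (Inr j) \<in> G j" if "j \<in> L" for j
    using c that by (force simp: N_eq)
  have prods: "(\<Prod>k\<in>N. prob (c k)) = (\<Prod>i\<in>K. prob (c (Inl i))) * (\<Prod>j\<in>L. prob (c (Inr j)))"
    unfolding N_eq using KL by (subst prod.union_disjoint) (auto simp: prod.reindex)
  have pK: "prob (\<Inter>i\<in>K. c (Inl i)) = (\<Prod>i\<in>K. prob (c (Inl i)))" if "K \<noteq> {}"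
    using indep_setsD[OF F KL(3) that KL(1)] cK by auto
  have pL: "prob (\<Inter>j\<in>L. c (Inr j)) = (\<Prod>j\<in>L. prob (c (Inr j)))" if "L \<noteq> {}"
    using indep_setsD[OF G KL(4) that KL(2)] cL by auto
  have inter: "(\<Inter>k\<in>N. c k) = (\<Inter>i\<in>K. c (Inl i)) \<inter> (\<Inter>j\<in>L. c (Inr j))"
    by (auto simp: N_eq)
  consider "K = {}" | "L = {}" | "K \<noteq> {}" "L \<noteq> {}" by blast
  then show "prob (\<Inter>k\<in>N. c k) = (\<Prod>k\<in>N. prob (c k))"
  proof cases
    case 1
    with N(1) N_eq have "L \<noteq> {}" by auto
    with 1 pL show ?thesis by (simp add: inter prods)
  next
    case 2
    with N(1) N_eq have "K \<noteq> {}" by auto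
    with 2 pK show ?thesis by (simp add: inter prods)
  next
    case 3
    then show ?thesis
      unfolding inter prods using FG[of K L "\<lambda>i. c (Inl i)" "\<lambda>j. c (Inr j)"] KL cK cL pK pL by simp
  qed
qed

text \<open>
  A finite intersection of preimages under the members is a cylinder event of the whole family, so
  that independence of the two families as random elements of a product space applies to it.
\<close>

lemma finite_Inter_preimages_eq_preimage:
  assumes K: "finite K" "K \<noteq> {}" "K \<subseteq> I"
    and a: "\<And>i. i \<in> K \<Longrightarrow> a i \<in> {X i -` S \<inter> space M |S. S \<in> sets (N i)}"
    and X: "\<And>i. i \<in> I \<Longrightarrow> X i \<in> M \<rightarrow>\<^sub>M N i"
  shows "\<exists>S \<in> sets (PiM I N). (\<Inter>i\<in>K. a i) = (\<lambda>\<omega>. \<lambda>i\<in>I. X i \<omega>) -` S \<inter> space M"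
proof -
  obtain S where S: "\<And>i. i \<in> K \<Longrightarrow> S i \<in> sets (N i)" "\<And>i. i \<in> K \<Longrightarrow> a i = X i -` S i \<inter> space M"
    using a by simp metis
  have "prod_emb I N K (Pi\<^sub>E K S) \<in> sets (PiM I N)"
    using K S by (intro sets_PiM_I) auto
  moreover have "(\<Inter>i\<in>K. a i) = (\<lambda>\<omega>. \<lambda>i\<in>I. X i \<omega>) -` prod_emb I N K (Pi\<^sub>E K S) \<inter> space M"
    using K S measurable_space[OF X] by (auto simp: prod_emb_def PiE_iff subset_iff)
  ultimately show ?thesis by blast
qed

lemma preimages_comp_subset:
  assumes X: "X \<in> M \<rightarrow>\<^sub>M N" and f: "f \<in> N \<rightarrow>\<^sub>M L"
  shows "{(\<lambda>\<omega>. f (X \<omega>)) -` S \<inter> space M |S. S \<in> sets L} \<subseteq> {X -` S \<inter> space M |S. S \<in> sets N}"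
proof safe
  fix S assume "S \<in> sets L"
  then have "f -` S \<inter> space N \<in> sets N" by (rule measurable_sets[OF f])
  moreover have "(\<lambda>\<omega>. f (X \<omega>)) -` S \<inter> space M = X -` (f -` S \<inter> space N) \<inter> space M"
    using measurable_space[OF X] by auto
  ultimately show "\<exists>T. (\<lambda>\<omega>. f (X \<omega>)) -` S \<inter> space M = X -` T \<inter> space M \<and> T \<in> sets N"
    by blast
qed

text \<open>
  The maps \<open>f\<close> and \<open>h\<close> embed the two value spaces into a common type, which
  \<^const>\<open>prob_space.indep_vars\<close> demands of a single family.
\<close>

lemma (in prob_space) indep_vars_sum:
  assumes X: "indep_vars M1 X I" and Y: "indep_vars M2 Y J"
    and XY: "indep_rv (PiM I M1) (\<lambda>\<omega>. \<lambda>i\<in>I. X i \<omega>) (PiM J M2) (\<lambda>\<omega>. \<lambda>j\<in>J. Y j \<omega>)"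
    and f: "\<And>i. i \<in> I \<Longrightarrow> f i \<in> M1 i \<rightarrow>\<^sub>M N (Inl i)" and h: "\<And>j. j \<in> J \<Longrightarrow> h j \<in> M2 j \<rightarrow>\<^sub>M N (Inr j)"
  shows "indep_vars N (case_sum (\<lambda>i \<omega>. f i (X i \<omega>)) (\<lambda>j \<omega>. h j (Y j \<omega>))) (I <+> J)"
proof -
  let ?F = "\<lambda>i. {X i -` S \<inter> space M |S. S \<in> sets (M1 i)}"
  let ?G = "\<lambda>j. {Y j -` S \<inter> space M |S. S \<in> sets (M2 j)}"
  have rv: "\<And>i. i \<in> I \<Longrightarrow> random_variable (M1 i) (X i)" "\<And>j. j \<in> J \<Longrightarrow> random_variable (M2 j) (Y j)"
    using X Y by (auto simp: indep_vars_def2)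
  have "indep_sets (case_sum ?F ?G) (I <+> J)"
  proof (rule indep_sets_sum)
    show "indep_sets ?F I" "indep_sets ?G J"
      using X Y by (auto simp: indep_vars_def2)
    fix K L a b
    assume K: "finite K" "K \<noteq> {}" "K \<subseteq> I" and L: "finite L" "L \<noteq> {}" "L \<subseteq> J"
      and a: "\<And>i. i \<in> K \<Longrightarrow> a i \<in> ?F i" and b: "\<And>j. j \<in> L \<Longrightarrow> b j \<in> ?G j"
    have "\<exists>S \<in> sets (PiM I M1). (\<Inter>i\<in>K. a i) = (\<lambda>\<omega>. \<lambda>i\<in>I. X i \<omega>) -` S \<inter> space M"
    proof (rule finite_Inter_preimages_eq_preimage[OF K])
      show "a i \<in> ?F i" if "i \<in> K" for i using that by (rule a)
      show "random_variable (M1 i) (X i)" if "i \<in> I" for i using that by (rule rv(1))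
    qed
    moreover have "\<exists>S \<in> sets (PiM J M2). (\<Inter>j\<in>L. b j) = (\<lambda>\<omega>. \<lambda>j\<in>J. Y j \<omega>) -` S \<inter> space M"
    proof (rule finite_Inter_preimages_eq_preimage[OF L])
      show "b j \<in> ?G j" if "j \<in> L" for j using that by (rule b)
      show "random_variable (M2 j) (Y j)" if "j \<in> J" for j using that by (rule rv(2))
    qed
    ultimately obtain S T where ST: "S \<in> sets (PiM I M1)" "T \<in> sets (PiM J M2)"
      and eqs: "(\<Inter>i\<in>K. a i) = (\<lambda>\<omega>. \<lambda>i\<in>I. X i \<omega>) -` S \<inter> space M"
        "(\<Inter>j\<in>L. b j) = (\<lambda>\<omega>. \<lambda>j\<in>J. Y j \<omega>) -` T \<inter> space M"
      by blast
    have "indep_set {(\<lambda>\<omega>. \<lambda>i\<in>I. X i \<omega>) -` S \<inter> space M |S. S \<in> sets (PiM I M1)}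
        {(\<lambda>\<omega>. \<lambda>j\<in>J. Y j \<omega>) -` S \<inter> space M |S. S \<in> sets (PiM J M2)}"
      using XY by (simp add: indep_rv_def)
    then show "prob ((\<Inter>i\<in>K. a i) \<inter> (\<Inter>j\<in>L. b j)) = prob (\<Inter>i\<in>K. a i) * prob (\<Inter>j\<in>L. b j)"
      unfolding eqs by (rule indep_setD) (use ST in blast)+
  qed
  moreover have sub_F: "{(\<lambda>\<omega>. f i (X i \<omega>)) -` S \<inter> space M |S. S \<in> sets (N (Inl i))} \<subseteq> ?F i" if "i \<in> I" for i
    by (rule preimages_comp_subset[OF rv(1)[OF that] f[OF that]])
  moreover have sub_G: "{(\<lambda>\<omega>. h j (Y j \<omega>)) -` S \<inter> space M |S. S \<in> sets (N (Inr j))} \<subseteq> ?G j" if "j \<in> J" for j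
    by (rule preimages_comp_subset[OF rv(2)[OF that] h[OF that]])
  ultimately have "indep_sets (\<lambda>k. {case_sum (\<lambda>i \<omega>. f i (X i \<omega>)) (\<lambda>j \<omega>. h j (Y j \<omega>)) k -` S \<inter> space M |S. S \<in> sets (N k)}) (I <+> J)"
  proof (elim indep_sets_mono_sets)
    fix k assume "k \<in> I <+> J"
    then consider (l) i where "i \<in> I" "k = Inl i" | (r) j where "j \<in> J" "k = Inr j" by blast
    then show "{case_sum (\<lambda>i \<omega>. f i (X i \<omega>)) (\<lambda>j \<omega>. h j (Y j \<omega>)) k -` S \<inter> space M |S. S \<in> sets (N k)}
        \<subseteq> case_sum ?F ?G k"
    proof cases
      case l
      show ?thesis unfolding l(2) sum.case by (rule sub_F[OF l(1)])
    next
      case r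
      show ?thesis unfolding r(2) sum.case by (rule sub_G[OF r(1)])
    qed
  qed
  then show ?thesis
    unfolding indep_vars_def2 
    using measurable_compose[OF rv(1) f] measurable_compose[OF rv(2) h] by auto
qed

section \<open>The one-step transition\<close>

text \<open>
  Average of \<open>H\<close> over the four possible moves from \<open>x\<close>: arm A is played with probability \<open>x\<close> and wins
  with probability \<open>p\<close>, arm B is played otherwise and wins with probability \<open>q\<close>.
\<close>

definition transition ::
  "real \<Rightarrow> real \<Rightarrow> real \<Rightarrow> real \<Rightarrow> (real \<Rightarrow> real) \<Rightarrow> real \<Rightarrow> real" where
  "transition p q g r H x =
     x * (p * H (x + g * (1 - x)) + (1 - p) * H (x - g * r * x)) +
     (1 - x) * (q * H (x - g * x) + (1 - q) * H (x + g * r * (1 - x)))"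

lemma unit_interval_moves:
  fixes k y :: real
  assumes "0 < k" "k < 1" "0 \<le> y" "y \<le> 1"
  shows "0 \<le> y + k * (1 - y)" "y + k * (1 - y) \<le> 1" "0 \<le> y - k * y" "y - k * y \<le> 1"
proof -
  have "0 \<le> k * (1 - y)" "0 \<le> k * y" "k * (1 - y) \<le> 1 - y" "k * y \<le> y"
    using assms by (auto intro: mult_nonneg_nonneg mult_left_le_one_le)
  with assms show "0 \<le> y + k * (1 - y)" "y + k * (1 - y) \<le> 1" "0 \<le> y - k * y" "y - k * y \<le> 1"
    by linarith+
qed

context penalized_bandit
begin

abbreviation "noise_algebra \<equiv> borel \<Otimes>\<^sub>M (borel :: real measure)"

text \<open>
  All sources of randomness as one family: the events at time \<open>n\<close> have index \<open>Inl n\<close>, the uniform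
  variable at time \<open>n\<close> has index \<open>Inr n\<close> and is padded to a pair.
\<close>

definition noise :: "nat + nat \<Rightarrow> 'a \<Rightarrow> real \<times> real" where
  "noise = case_sum (\<lambda>n \<omega>. (indicator (A n) \<omega>, indicator (B n) \<omega>)) (\<lambda>n \<omega>. (U n \<omega>, 0))"

lemma indep_noise: "indep_vars (\<lambda>_. noise_algebra) noise ({1..} <+> {1..})"
proof -
  have "indep_vars (\<lambda>_. noise_algebra)
     (case_sum (\<lambda>n \<omega>. id (indicator (A n) \<omega> :: real, indicator (B n) \<omega> :: real)) (\<lambda>n \<omega>. (\<lambda>u. (u, 0)) (U n \<omega>))) ({1..} <+> {1..})"
    by (rule indep_vars_sum[OF AB_indep U_indep AB_U_indep]) auto
  then show ?thesis by (simp add: noise_def)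
qed

abbreviation X :: "nat \<Rightarrow> 'a \<Rightarrow> real" where
  "X \<equiv> bandit \<gamma> \<rho> U A B x"

definition past :: "nat \<Rightarrow> (nat + nat) set" where
  "past n = {1..n} <+> {1..n}"

lemma bandit_eq_cases:
  "X (Suc n) \<omega> =
    (if U (Suc n) \<omega> \<le> X n \<omega>
     then if \<omega> \<in> A (Suc n) then X n \<omega> + \<gamma> (Suc n) * (1 - X n \<omega>)
          else X n \<omega> - \<gamma> (Suc n) * \<rho> (Suc n) * X n \<omega>
     else if \<omega> \<in> B (Suc n) then X n \<omega> - \<gamma> (Suc n) * X n \<omega>
          else X n \<omega> + \<gamma> (Suc n) * \<rho> (Suc n) * (1 - X n \<omega>))"
  by (simp add: Let_def indicator_def)

lemma bandit_bounds: "0 \<le> X n \<omega>" "X n \<omega> \<le> 1"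
proof (induction n)
  case 0
  show "0 \<le> X 0 \<omega>" "X 0 \<omega> \<le> 1" using x_pos x_less_1 by auto
next
  case (Suc n)
  have g: "0 < \<gamma> (Suc n)" "\<gamma> (Suc n) < 1" and gr: "0 < \<gamma> (Suc n) * \<rho> (Suc n)" "\<gamma> (Suc n) * \<rho> (Suc n) < 1"
    using \<gamma>_pos \<gamma>_less_1 \<rho>_pos \<gamma>_\<rho>_less_1 by auto
  show "0 \<le> X (Suc n) \<omega>" "X (Suc n) \<omega> \<le> 1"
    unfolding bandit_eq_cases using unit_interval_moves[OF g Suc.IH] unit_interval_moves[OF gr Suc.IH]
    by auto
qed

text \<open>
  Measurability with respect to the past is stated as a factorisation, because independence of
  disjoint blocks of \<^const>\<open>noise\<close> transfers to measurable functions of the blocks.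
\<close>

lemma bandit_factors_through_past:
  "\<exists>\<Phi> \<in> borel_measurable (PiM (past n) (\<lambda>_. noise_algebra)).
     X n = (\<lambda>\<omega>. \<Phi> (restrict (\<lambda>k. noise k \<omega>) (past n)))"
proof (induction n)
  case 0
  show ?case by (intro bexI[of _ "\<lambda>_. x"]) auto
next
  case (Suc n)
  then obtain \<Phi> where \<Phi>[measurable]: "\<Phi> \<in> borel_measurable (PiM (past n) (\<lambda>_. noise_algebra))"
    and X: "X n = (\<lambda>\<omega>. \<Phi> (restrict (\<lambda>k. noise k \<omega>) (past n)))" by blast
  have sub: "past n \<subseteq> past (Suc n)" by (auto simp: past_def)
  have new[measurable]: "Inl (Suc n) \<in> past (Suc n)" "Inr (Suc n) \<in> past (Suc n)" by (auto simp: past_def)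
  define \<Psi> where "\<Psi> z = (let y = \<Phi> (restrict z (past n)); u = fst (z (Inr (Suc n)));
      a = fst (z (Inl (Suc n))); b = snd (z (Inl (Suc n))) in
    if u \<le> y
     then if a = 1 then y + \<gamma> (Suc n) * (1 - y)
          else y - \<gamma> (Suc n) * \<rho> (Suc n) * y
     else if b = 1 then y - \<gamma> (Suc n) * y
          else y + \<gamma> (Suc n) * \<rho> (Suc n) * (1 - y))" for z
  have [measurable]: "(\<lambda>z. \<Phi> (restrict z (past n))) \<in> borel_measurable (PiM (past (Suc n)) (\<lambda>_. noise_algebra))"
    using measurable_restrict_subset[OF sub] \<Phi> by (rule measurable_compose)
  have [measurable]: "(\<lambda>z. z (Inl (Suc n))) \<in> PiM (past (Suc n)) (\<lambda>_. noise_algebra) \<rightarrow>\<^sub>M noise_algebra"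
    "(\<lambda>z. z (Inr (Suc n))) \<in> PiM (past (Suc n)) (\<lambda>_. noise_algebra) \<rightarrow>\<^sub>M noise_algebra"
    using new by (auto intro: measurable_component_singleton)
  have "\<Psi> \<in> borel_measurable (PiM (past (Suc n)) (\<lambda>_. noise_algebra))"
    unfolding \<Psi>_def Let_def by measurable
  moreover have "X (Suc n) \<omega> = \<Psi> (restrict (\<lambda>k. noise k \<omega>) (past (Suc n)))" for \<omega>
  proof -
    have "\<Phi> (restrict (restrict (\<lambda>k. noise k \<omega>) (past (Suc n))) (past n)) = X n \<omega>"
      using sub by (simp add: X Int_absorb1)
    then show ?thesis
      unfolding bandit_eq_cases \<Psi>_def Let_def using new by (simp add: noise_def indicator_def)
  qed
  ultimately show ?case by blast
qed

lemma random_variable_U [measurable]: "random_variable borel (U (Suc n))"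
  using U_indep by (auto simp: indep_vars_def2)

lemma A_B_events [measurable]: "A (Suc n) \<in> events" "B (Suc n) \<in> events"
  using A_event B_event by auto

lemma measurable_restrict_noise:
  "K \<subseteq> {1..} <+> {1..} \<Longrightarrow> (\<lambda>\<omega>. restrict (\<lambda>k. noise k \<omega>) K) \<in> M \<rightarrow>\<^sub>M PiM K (\<lambda>_. noise_algebra)"
  using indep_noise by (intro measurable_restrict) (auto simp: indep_vars_def2)

lemma random_variable_bandit [measurable]: "random_variable borel (X n)"
proof -
  obtain \<Phi> where "\<Phi> \<in> borel_measurable (PiM (past n) (\<lambda>_. noise_algebra))"
    "X n = (\<lambda>\<omega>. \<Phi> (restrict (\<lambda>k. noise k \<omega>) (past n)))"
    using bandit_factors_through_past by blast
  moreover have "past n \<subseteq> {1..} <+> {1..}" by (auto simp: past_def)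
  ultimately show ?thesis
    using measurable_compose[OF measurable_restrict_noise] by auto
qed

lemma indep_var_bandit_U: "indep_var borel (X n) borel (U (Suc n))"
proof -
  obtain \<Phi> where \<Phi>: "\<Phi> \<in> borel_measurable (PiM (past n) (\<lambda>_. noise_algebra))"
    "X n = (\<lambda>\<omega>. \<Phi> (restrict (\<lambda>k. noise k \<omega>) (past n)))"
    using bandit_factors_through_past by blast
  have "indep_var (PiM (past n) (\<lambda>_. noise_algebra)) (\<lambda>\<omega>. restrict (\<lambda>k. noise k \<omega>) (past n))
      (PiM {Inr (Suc n)} (\<lambda>_. noise_algebra)) (\<lambda>\<omega>. restrict (\<lambda>k. noise k \<omega>) {Inr (Suc n)})"
    by (rule indep_var_restrict[OF indep_noise]) (auto simp: past_def)
  from indep_var_compose[OF this \<Phi>(1), of "\<lambda>z. fst (z (Inr (Suc n)))" borel]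
  show ?thesis by (simp add: \<Phi>(2) noise_def comp_def)
qed

lemma indep_var_bandit_U_AB:
  "indep_var (borel \<Otimes>\<^sub>M borel) (\<lambda>\<omega>. (X n \<omega>, U (Suc n) \<omega>))
     noise_algebra (\<lambda>\<omega>. (indicator (A (Suc n)) \<omega>, indicator (B (Suc n)) \<omega>))"
proof -
  obtain \<Phi> where \<Phi>: "\<Phi> \<in> borel_measurable (PiM (past n) (\<lambda>_. noise_algebra))"
    "X n = (\<lambda>\<omega>. \<Phi> (restrict (\<lambda>k. noise k \<omega>) (past n)))"
    using bandit_factors_through_past by blast
  let ?K = "insert (Inr (Suc n)) (past n)"
  have indep: "indep_var (PiM ?K (\<lambda>_. noise_algebra)) (\<lambda>\<omega>. restrict (\<lambda>k. noise k \<omega>) ?K)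
      (PiM {Inl (Suc n)} (\<lambda>_. noise_algebra)) (\<lambda>\<omega>. restrict (\<lambda>k. noise k \<omega>) {Inl (Suc n)})"
    by (rule indep_var_restrict[OF indep_noise]) (auto simp: past_def)
  have [measurable]: "(\<lambda>z. \<Phi> (restrict z (past n))) \<in> borel_measurable (PiM ?K (\<lambda>_. noise_algebra))"
    using measurable_restrict_subset[of "past n" ?K] \<Phi>(1) by (rule measurable_compose) auto
  have "(\<lambda>z. (\<Phi> (restrict z (past n)), fst (z (Inr (Suc n))))) \<in> PiM ?K (\<lambda>_. noise_algebra) \<rightarrow>\<^sub>M (borel \<Otimes>\<^sub>M borel)"
    by measurable
  from indep_var_compose[OF indep this, of "\<lambda>z. z (Inl (Suc n))" noise_algebra]
  show ?thesis by (simp add: \<Phi>(2) noise_def comp_def Int_absorb1 subset_insertI)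
qed

text \<open>
  By Fubini, integrating out the independent uniform variable replaces the event that it lies below
  \<open>X n\<close> by its conditional probability \<open>X n\<close>.
\<close>

lemma expectation_U_le:
  assumes [measurable]: "\<phi> \<in> borel_measurable borel" and bd: "\<And>y. 0 \<le> y \<Longrightarrow> y \<le> 1 \<Longrightarrow> \<bar>\<phi> y\<bar> \<le> C"
  shows "expectation (\<lambda>\<omega>. of_bool (U (Suc n) \<omega> \<le> X n \<omega>) * \<phi> (X n \<omega>)) = expectation (\<lambda>\<omega>. X n \<omega> * \<phi> (X n \<omega>))"
proof -
  let ?P = "distr M borel (X n)" and ?Q = "distr M borel (U (Suc n))"
  interpret P: prob_space ?P by (rule prob_space_distr) simp
  interpret Q: prob_space ?Q by (rule prob_space_distr) simp
  interpret PQ: pair_prob_space ?P ?Q ..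
  have joint: "?P \<Otimes>\<^sub>M ?Q = distr M (borel \<Otimes>\<^sub>M borel) (\<lambda>\<omega>. (X n \<omega>, U (Suc n) \<omega>))"
    using indep_var_bandit_U by (simp add: indep_var_distribution_eq)
  let ?h = "\<lambda>(y, u). of_bool (u \<le> y) * \<phi> y :: real"
  have [measurable]: "?h \<in> borel_measurable (borel \<Otimes>\<^sub>M borel)" by measurable
  have "0 \<le> C" using bd[of 0] by simp
  then have "integrable M (\<lambda>\<omega>. ?h (X n \<omega>, U (Suc n) \<omega>))"
    using bandit_bounds bd by (intro integrable_const_bound[where B = C] AE_I2) 
      (auto simp: of_bool_def)
  then have int: "integrable (?P \<Otimes>\<^sub>M ?Q) ?h"
    unfolding joint by (subst integrable_distr_eq) auto
  have inner: "(\<integral>u. ?h (y, u) \<partial>?Q) = y * \<phi> y" if "0 \<le> y" "y \<le> 1" for y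
  proof -
    have "(\<integral>u. ?h (y, u) \<partial>?Q) = (\<integral>u. indicator {..y} u \<partial>?Q) * \<phi> y"
      by (simp add: indicator_def of_bool_def)
    also have "(\<integral>u. indicator {..y} u \<partial>?Q) = measure (uniform_measure lborel {0..1}) {..y}"
      using U_uniform[of "Suc n"] by simp
    also have "\<dots> = y"
    proof -
      have "{0..1} \<inter> {..y} = {0..y}" using that by auto
      then show ?thesis using that by simp
    qed
    finally show ?thesis .
  qed
  have "expectation (\<lambda>\<omega>. ?h (X n \<omega>, U (Suc n) \<omega>)) = integral\<^sup>L (?P \<Otimes>\<^sub>M ?Q) ?h"
    unfolding joint by (subst integral_distr) auto
  also have "\<dots> = (\<integral>y. (\<integral>u. ?h (y, u) \<partial>?Q) \<partial>?P)"
    by (rule PQ.integral_fst'[OF int, symmetric])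
  also have "\<dots> = expectation (\<lambda>\<omega>. \<integral>u. ?h (X n \<omega>, u) \<partial>?Q)"
    by (subst integral_distr) auto
  also have "\<dots> = expectation (\<lambda>\<omega>. X n \<omega> * \<phi> (X n \<omega>))"
    using inner bandit_bounds by (intro Bochner_Integration.integral_cong) auto
  finally show ?thesis by simp
qed

text \<open>
  \<open>X (Suc n)\<close> is one of four functions of \<open>X n\<close>, according to the arm played and its success. The
  indicator of success is independent of \<open>(X n, U (Suc n))\<close>, and the indicator of the arm played
  averages to \<open>X n\<close> or \<open>1 - X n\<close>. Each move involves only one of \<open>A\<close> and \<open>B\<close>, so the
  marginal probabilities determine the average.
\<close>

lemma
  assumes [measurable]: "H \<in> borel_measurable borel" and bd: "\<And>y. 0 \<le> y \<Longrightarrow> y \<le> 1 \<Longrightarrow> \<bar>H y\<bar> \<le> C"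
  shows integrable_transition:
      "integrable M (\<lambda>\<omega>. transition p_A p_B (\<gamma> (Suc n)) (\<rho> (Suc n)) H (X n \<omega>))" (is ?int)
    and expectation_transition:
      "expectation (\<lambda>\<omega>. H (X (Suc n) \<omega>))
        = expectation (\<lambda>\<omega>. transition p_A p_B (\<gamma> (Suc n)) (\<rho> (Suc n)) H (X n \<omega>))" (is ?eq)
proof -
  let ?g = "\<gamma> (Suc n)" and ?r = "\<rho> (Suc n)"
  have g: "0 < ?g" "?g < 1" and gr: "0 < ?g * ?r" "?g * ?r < 1"
    using \<gamma>_pos \<gamma>_less_1 \<rho>_pos \<gamma>_\<rho>_less_1 by auto
  let ?a = "indicator (A (Suc n)) :: 'a \<Rightarrow> real" and ?b = "indicator (B (Suc n)) :: 'a \<Rightarrow> real"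
  define l where "l \<omega> = (of_bool (U (Suc n) \<omega> \<le> X n \<omega>) :: real)" for \<omega>
  have [measurable]: "random_variable borel l" unfolding l_def by measurable
  define H1 where "H1 y = H (y + ?g * (1 - y))" for y
  define H2 where "H2 y = H (y - ?g * ?r * y)" for y
  define H3 where "H3 y = H (y - ?g * y)" for y
  define H4 where "H4 y = H (y + ?g * ?r * (1 - y))" for y
  have Hm[measurable]: "H1 \<in> borel_measurable borel" "H2 \<in> borel_measurable borel"
      "H3 \<in> borel_measurable borel" "H4 \<in> borel_measurable borel"
    unfolding H1_def H2_def H3_def H4_def by measurable
  have bds: "\<bar>H1 y\<bar> \<le> C" "\<bar>H2 y\<bar> \<le> C" "\<bar>H3 y\<bar> \<le> C" "\<bar>H4 y\<bar> \<le> C" if "0 \<le> y" "y \<le> 1" for y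
    unfolding H1_def H2_def H3_def H4_def
    using unit_interval_moves[OF g that] unit_interval_moves[OF gr that] by (auto intro!: bd)
  have C: "0 \<le> C" using bd[of 0] by simp
  have int: "integrable M (\<lambda>\<omega>. w \<omega> * \<phi> (X n \<omega>))"
    if [measurable]: "\<phi> \<in> borel_measurable borel" "random_variable borel w"
      and bd: "\<And>y. 0 \<le> y \<Longrightarrow> y \<le> 1 \<Longrightarrow> \<bar>\<phi> y\<bar> \<le> C" and w: "\<And>\<omega>. \<bar>w \<omega>\<bar> \<le> 1" for \<phi> w
  proof (rule integrable_const_bound[where B = C], rule AE_I2)
    show "norm (w \<omega> * \<phi> (X n \<omega>)) \<le> C" for \<omega>
      using mult_mono[OF w[of \<omega>] bd[OF bandit_bounds[of n \<omega>]]] C by (simp add: abs_mult)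
  qed measurable
  have l: "\<bar>l \<omega>\<bar> \<le> 1" "\<bar>1 - l \<omega>\<bar> \<le> 1" "\<bar>l \<omega> * ?a \<omega>\<bar> \<le> 1" "\<bar>(1 - l \<omega>) * ?b \<omega>\<bar> \<le> 1"
      "\<bar>X n \<omega>\<bar> \<le> 1" "\<bar>1 - X n \<omega>\<bar> \<le> 1" for \<omega>
    using bandit_bounds[of n \<omega>] by (auto simp: l_def indicator_def)
  \<comment> \<open>Each move carries one of these four weights; failures are written as complements of successes.\<close>
  have marginals:
    "expectation (\<lambda>\<omega>. l \<omega> * \<phi> (X n \<omega>)) = expectation (\<lambda>\<omega>. X n \<omega> * \<phi> (X n \<omega>))"
    "expectation (\<lambda>\<omega>. (1 - l \<omega>) * \<phi> (X n \<omega>)) = expectation (\<lambda>\<omega>. (1 - X n \<omega>) * \<phi> (X n \<omega>))"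
    "expectation (\<lambda>\<omega>. (l \<omega> * ?a \<omega>) * \<phi> (X n \<omega>)) = p_A * expectation (\<lambda>\<omega>. X n \<omega> * \<phi> (X n \<omega>))"
    "expectation (\<lambda>\<omega>. ((1 - l \<omega>) * ?b \<omega>) * \<phi> (X n \<omega>)) = p_B * expectation (\<lambda>\<omega>. (1 - X n \<omega>) * \<phi> (X n \<omega>))"
    if [measurable]: "\<phi> \<in> borel_measurable borel" and bd: "\<And>y. 0 \<le> y \<Longrightarrow> y \<le> 1 \<Longrightarrow> \<bar>\<phi> y\<bar> \<le> C" for \<phi>
  proof -
    note i = int[OF that(1) _ bd, simplified]
    have one: "integrable M (\<lambda>\<omega>. \<phi> (X n \<omega>))"
      using i[of "\<lambda>_. 1"] by simp
    show 1: "expectation (\<lambda>\<omega>. l \<omega> * \<phi> (X n \<omega>)) = expectation (\<lambda>\<omega>. X n \<omega> * \<phi> (X n \<omega>))"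
      unfolding l_def by (rule expectation_U_le[OF that])
    show 2: "expectation (\<lambda>\<omega>. (1 - l \<omega>) * \<phi> (X n \<omega>)) = expectation (\<lambda>\<omega>. (1 - X n \<omega>) * \<phi> (X n \<omega>))"
      unfolding left_diff_distrib using 1 one i[of l] i[of "X n"] l by simp
    have indicators: "integrable M ?a" "integrable M ?b"
      by (auto intro!: integrable_const_bound[where B = 1] AE_I2)
    have "indep_var borel (\<lambda>\<omega>. l \<omega> * \<phi> (X n \<omega>)) borel ?a"
      using indep_var_compose[OF indep_var_bandit_U_AB[of n],
          of "\<lambda>(y, u). of_bool (u \<le> y) * \<phi> y" borel fst borel]
      by (simp add: comp_def l_def)
    from indep_var_lebesgue_integral[OF this i]
    have "expectation (\<lambda>\<omega>. l \<omega> * \<phi> (X n \<omega>) * ?a \<omega>) = expectation (\<lambda>\<omega>. l \<omega> * \<phi> (X n \<omega>)) * p_A"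
      using l prob_A[of "Suc n"] indicators by simp
    then show "expectation (\<lambda>\<omega>. (l \<omega> * ?a \<omega>) * \<phi> (X n \<omega>)) = p_A * expectation (\<lambda>\<omega>. X n \<omega> * \<phi> (X n \<omega>))"
      using 1 by (simp add: mult_ac)
    have "indep_var borel (\<lambda>\<omega>. (1 - l \<omega>) * \<phi> (X n \<omega>)) borel ?b"
      using indep_var_compose[OF indep_var_bandit_U_AB[of n],
          of "\<lambda>(y, u). (1 - of_bool (u \<le> y)) * \<phi> y" borel snd borel]
      by (simp add: comp_def l_def)
    from indep_var_lebesgue_integral[OF this i]
    have "expectation (\<lambda>\<omega>. (1 - l \<omega>) * \<phi> (X n \<omega>) * ?b \<omega>) = expectation (\<lambda>\<omega>. (1 - l \<omega>) * \<phi> (X n \<omega>)) * p_B"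
      using l prob_B[of "Suc n"] indicators by simp
    then show "expectation (\<lambda>\<omega>. ((1 - l \<omega>) * ?b \<omega>) * \<phi> (X n \<omega>)) = p_B * expectation (\<lambda>\<omega>. (1 - X n \<omega>) * \<phi> (X n \<omega>))"
      using 2 by (simp add: mult_ac)
  qed
  have H_eq: "H (X (Suc n) \<omega>) = (l \<omega> * ?a \<omega>) * H1 (X n \<omega>) + (l \<omega> * H2 (X n \<omega>) - (l \<omega> * ?a \<omega>) * H2 (X n \<omega>))
      + ((1 - l \<omega>) * ?b \<omega>) * H3 (X n \<omega>)
      + ((1 - l \<omega>) * H4 (X n \<omega>) - ((1 - l \<omega>) * ?b \<omega>) * H4 (X n \<omega>))" for \<omega>
    unfolding bandit_eq_cases H1_def H2_def H3_def H4_def l_def by (auto simp: indicator_def)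
  have [measurable]: "random_variable borel (\<lambda>\<omega>. l \<omega> * ?a \<omega>)" "random_variable borel (\<lambda>\<omega>. (1 - l \<omega>) * ?b \<omega>)"
    "random_variable borel (\<lambda>\<omega>. 1 - l \<omega>)" "random_variable borel (\<lambda>\<omega>. 1 - X n \<omega>)"
    by measurable
  have i1: "integrable M (\<lambda>\<omega>. l \<omega> * ?a \<omega> * H1 (X n \<omega>))"
    by (rule int[OF Hm(1) _ bds(1) l(3)]) measurable
  have i2: "integrable M (\<lambda>\<omega>. l \<omega> * H2 (X n \<omega>))"
    by (rule int[OF Hm(2) _ bds(2) l(1)]) measurable
  have i3: "integrable M (\<lambda>\<omega>. l \<omega> * ?a \<omega> * H2 (X n \<omega>))"
    by (rule int[OF Hm(2) _ bds(2) l(3)]) measurable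
  have i4: "integrable M (\<lambda>\<omega>. (1 - l \<omega>) * ?b \<omega> * H3 (X n \<omega>))"
    by (rule int[OF Hm(3) _ bds(3) l(4)]) measurable
  have i5: "integrable M (\<lambda>\<omega>. (1 - l \<omega>) * H4 (X n \<omega>))"
    by (rule int[OF Hm(4) _ bds(4) l(2)]) measurable
  have i6: "integrable M (\<lambda>\<omega>. (1 - l \<omega>) * ?b \<omega> * H4 (X n \<omega>))"
    by (rule int[OF Hm(4) _ bds(4) l(4)]) measurable
  have i7: "integrable M (\<lambda>\<omega>. X n \<omega> * H1 (X n \<omega>))"
    by (rule int[OF Hm(1) _ bds(1) l(5)]) measurable
  have i8: "integrable M (\<lambda>\<omega>. X n \<omega> * H2 (X n \<omega>))"
    by (rule int[OF Hm(2) _ bds(2) l(5)]) measurable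
  have i9: "integrable M (\<lambda>\<omega>. (1 - X n \<omega>) * H3 (X n \<omega>))"
    by (rule int[OF Hm(3) _ bds(3) l(6)]) measurable
  have i10: "integrable M (\<lambda>\<omega>. (1 - X n \<omega>) * H4 (X n \<omega>))"
    by (rule int[OF Hm(4) _ bds(4) l(6)]) measurable
  note ints = i1 i2 i3 i4 i5 i6 i7 i8 i9 i10
  define E1 where "E1 = expectation (\<lambda>\<omega>. X n \<omega> * H1 (X n \<omega>))"
  define E2 where "E2 = expectation (\<lambda>\<omega>. X n \<omega> * H2 (X n \<omega>))"
  define E3 where "E3 = expectation (\<lambda>\<omega>. (1 - X n \<omega>) * H3 (X n \<omega>))"
  define E4 where "E4 = expectation (\<lambda>\<omega>. (1 - X n \<omega>) * H4 (X n \<omega>))"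
  have transition_eq: "transition p_A p_B ?g ?r H (X n \<omega>) =
      p_A * (X n \<omega> * H1 (X n \<omega>)) + (1 - p_A) * (X n \<omega> * H2 (X n \<omega>))
      + p_B * ((1 - X n \<omega>) * H3 (X n \<omega>)) + (1 - p_B) * ((1 - X n \<omega>) * H4 (X n \<omega>))" for \<omega>
    by (simp add: transition_def H1_def H2_def H3_def H4_def algebra_simps)
  have "expectation (\<lambda>\<omega>. H (X (Suc n) \<omega>)) = p_A * E1 + (E2 - p_A * E2) + p_B * E3 + (E4 - p_B * E4)"
    unfolding H_eq E1_def E2_def E3_def E4_def
    by (simp only: Bochner_Integration.integral_add Bochner_Integration.integral_diff
        Bochner_Integration.integrable_add Bochner_Integration.integrable_diff ints
        marginals(3)[OF Hm(1) bds(1)] marginals(1,3)[OF Hm(2) bds(2)]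
        marginals(4)[OF Hm(3) bds(3)] marginals(2,4)[OF Hm(4) bds(4)])
  also have "\<dots> = expectation (\<lambda>\<omega>. p_A * (X n \<omega> * H1 (X n \<omega>)) + (1 - p_A) * (X n \<omega> * H2 (X n \<omega>))
      + p_B * ((1 - X n \<omega>) * H3 (X n \<omega>)) + (1 - p_B) * ((1 - X n \<omega>) * H4 (X n \<omega>)))"
    unfolding E1_def E2_def E3_def E4_def
    by (simp only: Bochner_Integration.integral_add integral_mult_right_zero
        Bochner_Integration.integrable_add integrable_mult_right ints) (simp add: algebra_simps)
  finally show ?eq unfolding transition_eq .
  show ?int
    unfolding transition_eq
    by (simp only: Bochner_Integration.integrable_add integrable_mult_right ints)
qed

end

section \<open>The squared odds as a Lyapunov function\<close>

text \<open>
  Second order expansion of the squared odds along a jump \<open>d\<close>. Since the odds equal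
  \<open>(1 + r) / (x + r) - 1\<close>, their increment is explicit, and a jump that at most halves \<open>x + r\<close> costs
  only constant factors in the remainder.
\<close>

lemma square_odds_increment_le:
  fixes x r d :: real
  assumes x: "0 \<le> x" "x \<le> 1" and r: "0 < r" and d: "x + r + d \<ge> (x + r) / 2"
    and xd: "x + d \<le> 1"
  defines "s \<equiv> x + r" and "f \<equiv> (1 - x) / (x + r)"
  shows "((1 - (x + d)) / (x + d + r))\<^sup>2
    \<le> f\<^sup>2 - 2 * f * (1 + r) * d / s\<^sup>2 + (4 * f * (1 + r) / s ^ 3 + 4 * (1 + r)\<^sup>2 / s ^ 4) * d\<^sup>2"
proof -
  have s: "s > 0" and sd: "s + d \<ge> s / 2" "s + d > 0"
    using assms by (auto simp: s_def field_simps)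
  have f: "f \<ge> 0" using x s by (simp add: f_def s_def)
  \<comment> \<open>The decrease of the odds.\<close>
  define t where "t = (1 + r) * d / (s * (s + d))"
  have eq: "(1 - (x + d)) / (x + d + r) = f - t"
    using s sd(2) by (simp add: f_def t_def s_def divide_simps) (simp add: algebra_simps)
  have inv: "1 / (s + d) \<le> 2 / s"
    using s sd by (simp add: field_simps)
  have t_ge: "- t \<le> - (1 + r) * d / s\<^sup>2 + 2 * (1 + r) * d\<^sup>2 / s ^ 3"
  proof -
    have "- t = - (1 + r) * d / s\<^sup>2 + (1 + r) * d\<^sup>2 / s\<^sup>2 * (1 / (s + d))"
      using s sd(2) by (simp add: t_def divide_simps) (simp add: algebra_simps power2_eq_square)
    also have "\<dots> \<le> - (1 + r) * d / s\<^sup>2 + (1 + r) * d\<^sup>2 / s\<^sup>2 * (2 / s)"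
      using inv r by (intro add_left_mono mult_left_mono) auto
    finally show ?thesis using s by (simp add: power3_eq_cube power2_eq_square mult_ac)
  qed
  have "t\<^sup>2 = ((1 + r) * d / s)\<^sup>2 * (1 / (s + d))\<^sup>2"
    by (simp add: t_def power2_eq_square)
  also have "\<dots> \<le> ((1 + r) * d / s)\<^sup>2 * (2 / s)\<^sup>2"
    using inv sd s by (intro mult_left_mono power_mono) auto
  finally have t2: "t\<^sup>2 \<le> 4 * (1 + r)\<^sup>2 * d\<^sup>2 / s ^ 4"
    by (simp add: power2_eq_square power4_eq_xxxx mult_ac)
  have "(f - t)\<^sup>2 = f\<^sup>2 + 2 * f * (- t) + t\<^sup>2"
    by (simp add: power2_eq_square algebra_simps)
  also have "\<dots> \<le> f\<^sup>2 + 2 * f * (- (1 + r) * d / s\<^sup>2 + 2 * (1 + r) * d\<^sup>2 / s ^ 3)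
      + 4 * (1 + r)\<^sup>2 * d\<^sup>2 / s ^ 4"
    using t_ge t2 f by (intro add_mono mult_left_mono) auto
  finally show ?thesis
    unfolding eq by (simp add: algebra_simps add_divide_distrib diff_divide_distrib)
qed

text \<open>
  The remainder coefficient times \<open>x (1 - x) + r\<^sup>2\<close>, which bounds the second moment of a jump
  divided by \<open>g\<^sup>2\<close>. The factor \<open>1 / r\<close> on the right comes near \<open>x = 1\<close> from the variance \<open>1 - x\<close>, of
  order \<open>r\<close> instead of \<open>r\<^sup>2\<close>, and near \<open>x = 0\<close> from \<open>1 / (x + r) \<le> 1 / r\<close>; it is later compensated
  by \<open>g / r \<longlonglongrightarrow> 0\<close>. The value 156 is merely what the estimates add up to.
\<close>

lemma second_order_bound:
  fixes x r :: real
  assumes x: "0 \<le> x" "x \<le> 1" and r: "0 < r" "r \<le> 1"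
  defines "s \<equiv> x + r" and "f \<equiv> (1 - x) / (x + r)"
  shows "(4 * f * (1 + r) / s ^ 3 + 4 * (1 + r)\<^sup>2 / s ^ 4) * (x * (1 - x) + r\<^sup>2)
    \<le> 156 * (f\<^sup>2 + r\<^sup>2) / r"
proof -
  define i where "i = 1 / s"
  define b where "b = (f\<^sup>2 + r\<^sup>2) / r"
  have s: "s > 0" and f: "f \<ge> 0" and i: "i > 0" 
    using x r by (auto simp: s_def f_def i_def)
  have f_i: "f = (1 - x) * i" by (simp add: f_def i_def s_def)
  have i_f: "i \<le> 1 + f" and i_r: "i \<le> 1 / r" and ri: "r * i \<le> 1" and xi: "x * i \<le> 1"
    using x r s by (auto simp: i_def f_def s_def divide_simps)
  have b_f: "f \<le> b / 2"
    using r sum_squares_bound[of f r] by (simp add: b_def field_simps)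
  have b_sq: "f\<^sup>2 + r\<^sup>2 \<le> b"
    using r mult_left_le[of r "f\<^sup>2 + r\<^sup>2"] by (simp add: b_def pos_le_divide_eq)
  have b_fr: "f\<^sup>2 * (1 / r) \<le> b"
    using r by (simp add: b_def divide_right_mono)
  have ffi: "f\<^sup>2 * i \<le> b"
    using mult_left_mono[OF i_r, of "f\<^sup>2"] b_fr by simp
  have fi: "f * i \<le> b / 2 + f\<^sup>2"
    using mult_left_mono[OF i_f f] b_f by (simp add: algebra_simps power2_eq_square)
  have one_f: "(1 + f)\<^sup>2 \<le> 2 + 2 * f\<^sup>2"
    using sum_squares_bound[of 1 f] by (simp add: power2_sum)
  have ri2: "(r * i)\<^sup>2 \<le> 1"
    using ri i r by (simp add: power_le_one)
  have i2: "i\<^sup>2 \<le> 2 + 2 * f\<^sup>2"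
    using power_mono[OF i_f, of 2] one_f i by simp
  have t1: "f * i ^ 3 * (x * (1 - x)) \<le> b"
  proof -
    have "f * i ^ 3 * (x * (1 - x)) = (f\<^sup>2 * i) * (x * i)"
      by (simp add: f_i power2_eq_square power3_eq_cube mult_ac)
    also have "\<dots> \<le> f\<^sup>2 * i * 1"
      using xi i by (intro mult_left_mono) auto
    finally show ?thesis using ffi by simp
  qed
  have t2: "f * i ^ 3 * r\<^sup>2 \<le> 3 / 2 * b"
  proof -
    have "f * i ^ 3 * r\<^sup>2 = f * i * (r * i)\<^sup>2"
      by (simp add: power2_eq_square power3_eq_cube mult_ac)
    also have "\<dots> \<le> f * i * 1"
      using ri2 f i by (intro mult_left_mono) auto
    also have "\<dots> \<le> b / 2 + (f\<^sup>2 + r\<^sup>2)"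
      using fi zero_le_power2[of r] by linarith
    finally show ?thesis using b_sq by simp
  qed
  have t3: "i ^ 4 * (x * (1 - x)) \<le> 5 / 2 * b"
  proof -
    have "i ^ 4 * (x * (1 - x)) = f * i\<^sup>2 * (x * i)"
      by (simp add: f_i power2_eq_square power4_eq_xxxx mult_ac)
    also have "\<dots> \<le> f * i\<^sup>2 * 1"
      using xi i f by (intro mult_left_mono) auto
    also have "\<dots> = f * i * i" by (simp add: power2_eq_square)
    also have "\<dots> \<le> f * i * (1 + f)"
      using i_f i f by (intro mult_left_mono) auto
    also have "\<dots> = f * i + f\<^sup>2 * i" by (simp add: algebra_simps power2_eq_square)
    finally show ?thesis using fi ffi b_sq zero_le_power2[of r] by linarith
  qed
  have t4: "i ^ 4 * r\<^sup>2 \<le> 6 * b"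
  proof -
    have "i ^ 4 * r\<^sup>2 = (r * i)\<^sup>2 * i\<^sup>2"
      by (simp add: power2_eq_square power4_eq_xxxx mult_ac)
    also have "\<dots> \<le> (r * i)\<^sup>2 * (2 + 2 * f\<^sup>2)"
      using i2 by (intro mult_left_mono) auto
    also have "\<dots> = 2 * (r\<^sup>2 * i\<^sup>2) + 2 * ((r * i)\<^sup>2 * f\<^sup>2)"
      by (simp add: algebra_simps power_mult_distrib)
    also have "\<dots> \<le> 2 * (r\<^sup>2 * (2 + 2 * f\<^sup>2)) + 2 * (1 * f\<^sup>2)"
      using i2 ri2 by (intro add_mono mult_left_mono mult_right_mono) auto
    also have "\<dots> \<le> 4 * r\<^sup>2 + 4 * f\<^sup>2 + 2 * f\<^sup>2"
      using mult_right_mono[of "r\<^sup>2" 1 "f\<^sup>2"] r by (simp add: algebra_simps power_le_one)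
    finally show ?thesis using b_sq zero_le_power2[of r] by linarith
  qed
  have m: "x * (1 - x) + r\<^sup>2 \<ge> 0" using x by simp
  have "(1 + r)\<^sup>2 \<le> 2\<^sup>2" using r by (intro power_mono) auto
  then have coef: "4 * f * (1 + r) / s ^ 3 + 4 * (1 + r)\<^sup>2 / s ^ 4 \<le> 8 * (f * i ^ 3) + 16 * i ^ 4"
    using r f s by (intro add_mono) (auto simp: i_def power_one_over field_simps intro!: mult_left_mono)
  have "(4 * f * (1 + r) / s ^ 3 + 4 * (1 + r)\<^sup>2 / s ^ 4) * (x * (1 - x) + r\<^sup>2)
      \<le> (8 * (f * i ^ 3) + 16 * i ^ 4) * (x * (1 - x) + r\<^sup>2)"
    using coef m by (rule mult_right_mono)
  also have "\<dots> = 8 * (f * i ^ 3 * (x * (1 - x))) + 8 * (f * i ^ 3 * r\<^sup>2)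
      + 16 * (i ^ 4 * (x * (1 - x))) + 16 * (i ^ 4 * r\<^sup>2)"
    by (simp add: algebra_simps)
  also have "\<dots> \<le> 156 * b"
    using t1 t2 t3 t4 b_sq by linarith
  finally show ?thesis by (simp add: b_def)
qed

text \<open>
  The mean of a jump is \<open>g b\<close> with
  \<open>b = (1 - x) ((p - q) x + r (1 - q) (1 - x)) - r (1 - p) x\<^sup>2\<close>, and \<open>1 - q \<ge> p - q\<close> makes the first
  product at least \<open>(p - q) (1 - r) (1 - x) (x + r)\<close>, uniformly in \<open>x\<close>: near \<open>0\<close> the
  penalty on a losing arm B replaces the vanishing term \<open>(p - q) x\<close>. The source term
  \<open>2 f r (1 - p)\<close> is split by \<open>2 f (c r) \<le> f\<^sup>2 + (c r)\<^sup>2\<close>; this is an equality when \<open>f = c r\<close>, which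
  is why the resulting fixed point is the sharp value \<open>c\<^sup>2 r\<^sup>2\<close>. It uses up half of the contraction
  rate \<open>2 (p - q)\<close> of the square.
\<close>

lemma transition_square_odds_le:
  fixes x g r p q :: real
  assumes q: "0 < q" and qp: "q < p" and p: "p < 1"
    and x: "0 \<le> x" "x \<le> 1" and r: "0 < r" "r \<le> 1" and g: "0 < g" "g \<le> 1 / 2"
  defines "f \<equiv> (1 - x) / (x + r)" and "\<delta> \<equiv> 156 * g / r" and "c \<equiv> (1 - p) / (p - q)"
  shows "transition p q g r (\<lambda>y. ((1 - y) / (y + r))\<^sup>2) x
    \<le> (1 - g * ((p - q) * (1 - r - 2 * r\<^sup>2) - \<delta>)) * f\<^sup>2 + g * ((p - q) * c\<^sup>2 * (1 + r) + \<delta>) * r\<^sup>2"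
proof -
  define s where "s = x + r"
  define C where "C = 4 * f * (1 + r) / s ^ 3 + 4 * (1 + r)\<^sup>2 / s ^ 4"
  define L where "L d = f\<^sup>2 - 2 * f * (1 + r) / s\<^sup>2 * d + C * d\<^sup>2" for d
  define b where "b = (1 - x) * ((p - q) * x + r * (1 - q) * (1 - x)) - r * (1 - p) * x\<^sup>2"
  have s: "s > 0" using x r by (simp add: s_def)
  have f: "f \<ge> 0" using x r by (simp add: f_def)
  have C: "C \<ge> 0" using s f r by (simp add: C_def)
  have pc: "1 - p = (p - q) * c" using qp by (simp add: c_def)
  have H: "((1 - (x + d)) / ((x + d) + r))\<^sup>2 \<le> L d"
    if "s + d \<ge> s / 2" "x + d \<le> 1" for d
    using square_odds_increment_le[OF x r(1) _ that(2)] that(1)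
    by (simp add: L_def C_def s_def f_def)
  have half: "g * y \<le> y / 2" if "y \<ge> 0" for y
    using g mult_right_mono[OF g(2) that] by simp
  have gr: "g * r \<le> 1 / 2" "0 \<le> g * r"
    using g r mult_mono[of g "1/2" r 1] by auto
  have "g * (1 - x) \<le> 1 - x" "g * r * (1 - x) \<le> 1 - x"
    using mult_right_mono[of g 1 "1 - x"] mult_right_mono[of "g * r" 1 "1 - x"] x g gr by auto
  moreover have "g * r * x \<le> x / 2" "g * x \<le> x / 2"
    using mult_right_mono[OF gr(1), of x] half[of x] x by auto
  moreover have "0 \<le> g * (1 - x)" "0 \<le> g * r * (1 - x)" "0 \<le> g * x" "0 \<le> g * r * x"
    using x g gr by auto
  ultimately have jumps:
    "((1 - (x + g * (1 - x))) / ((x + g * (1 - x)) + r))\<^sup>2 \<le> L (g * (1 - x))"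
    "((1 - (x - g * r * x)) / ((x - g * r * x) + r))\<^sup>2 \<le> L (- (g * r * x))"
    "((1 - (x - g * x)) / ((x - g * x) + r))\<^sup>2 \<le> L (- (g * x))"
    "((1 - (x + g * r * (1 - x))) / ((x + g * r * (1 - x)) + r))\<^sup>2 \<le> L (g * r * (1 - x))"
    using H[of "g * (1 - x)"] H[of "- (g * r * x)"] H[of "- (g * x)"] H[of "g * r * (1 - x)"] x r s
    by (auto simp: s_def)
  have "transition p q g r (\<lambda>y. ((1 - y) / (y + r))\<^sup>2) x
    \<le> x * (p * L (g * (1 - x)) + (1 - p) * L (- (g * r * x))) +
      (1 - x) * (q * L (- (g * x)) + (1 - q) * L (g * r * (1 - x)))"
    unfolding transition_def using jumps x q qp p by (intro add_mono mult_left_mono) auto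
  also have "\<dots> = f\<^sup>2 - 2 * f * (1 + r) / s\<^sup>2 * (g * b)
      + C * (g\<^sup>2 * (x * (1 - x) * (p * (1 - x) + q * x) + r\<^sup>2 * ((1 - p) * x ^ 3 + (1 - q) * (1 - x) ^ 3)))"
    by (simp add: L_def b_def power2_eq_square power3_eq_cube) algebra
  also have "\<dots> \<le> f\<^sup>2 - 2 * f * (g * ((p - q) * (1 - r\<^sup>2) * f - (1 + r) * r * (1 - p)))
      + C * (g\<^sup>2 * (x * (1 - x) * 1 + r\<^sup>2 * 1))"
  proof (intro add_mono diff_mono order_refl mult_left_mono C)
    have "x + r - r * x \<ge> (1 - r) * s"
      using r x by (simp add: s_def algebra_simps)
    then have "(p - q) * ((1 - r) * s) \<le> (p - q) * (x + r - r * x)"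
      using qp by (intro mult_left_mono) auto
    also have "\<dots> = (p - q) * x + r * (p - q) * (1 - x)"
      by (simp add: algebra_simps)
    also have "\<dots> \<le> (p - q) * x + r * (1 - q) * (1 - x)"
      using p r x by (intro add_left_mono mult_right_mono mult_left_mono) auto
    finally have 1: "(1 - x) * ((p - q) * ((1 - r) * s)) \<le> (1 - x) * ((p - q) * x + r * (1 - q) * (1 - x))"
      using x by (intro mult_left_mono) auto
    have 2: "r * (1 - p) * x\<^sup>2 \<le> r * (1 - p) * s\<^sup>2"
      using r x p by (intro mult_left_mono power_mono) (auto simp: s_def)
    have fs: "1 - x = f * s" using s by (simp add: f_def s_def)
    have "((p - q) * (1 - r) * f - r * (1 - p)) * s\<^sup>2 \<le> b"
      using 1 2 unfolding b_def fs by (simp add: algebra_simps power2_eq_square)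
    then have "(p - q) * (1 - r) * f - r * (1 - p) \<le> b / s\<^sup>2"
      using s by (simp add: pos_le_divide_eq)
    then have "2 * f * (1 + r) * g * ((p - q) * (1 - r) * f - r * (1 - p)) \<le> 2 * f * (1 + r) * g * (b / s\<^sup>2)"
      using f r g by (intro mult_left_mono) auto
    moreover have "2 * f * (1 + r) * g * (b / s\<^sup>2) = 2 * f * (1 + r) / s\<^sup>2 * (g * b)"
      by simp
    moreover have "2 * f * (1 + r) * g * ((p - q) * (1 - r) * f - r * (1 - p))
        = 2 * f * (g * ((p - q) * (1 - r\<^sup>2) * f - (1 + r) * r * (1 - p)))"
      by (simp add: power2_eq_square algebra_simps)
    ultimately show "2 * f * (g * ((p - q) * (1 - r\<^sup>2) * f - (1 + r) * r * (1 - p)))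
        \<le> 2 * f * (1 + r) / s\<^sup>2 * (g * b)"
      by linarith
    show "p * (1 - x) + q * x \<le> 1"
      using convex_bound_le[of p 1 q "1 - x" x] p qp x by (simp add: mult.commute)
    have "x ^ 3 \<le> x" "(1 - x) ^ 3 \<le> 1 - x"
      using x power_decreasing[of 1 3 x] power_decreasing[of 1 3 "1 - x"] by auto
    then have "(1 - p) * x ^ 3 + (1 - q) * (1 - x) ^ 3 \<le> 1 * x + 1 * (1 - x)"
      using p qp q x by (intro add_mono mult_mono) auto
    then show "(1 - p) * x ^ 3 + (1 - q) * (1 - x) ^ 3 \<le> 1" by simp
  qed (use x in auto)
  also have "C * (g\<^sup>2 * (x * (1 - x) * 1 + r\<^sup>2 * 1)) \<le> g * \<delta> * (f\<^sup>2 + r\<^sup>2)"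
  proof -
    have "C * (x * (1 - x) + r\<^sup>2) \<le> 156 * (f\<^sup>2 + r\<^sup>2) / r"
      unfolding C_def f_def s_def by (rule second_order_bound[OF x r])
    then have "g\<^sup>2 * (C * (x * (1 - x) + r\<^sup>2)) \<le> g\<^sup>2 * (156 * (f\<^sup>2 + r\<^sup>2) / r)"
      by (intro mult_left_mono) auto
    then show ?thesis by (simp add: \<delta>_def power2_eq_square mult_ac)
  qed
  also have "f\<^sup>2 - 2 * f * (g * ((p - q) * (1 - r\<^sup>2) * f - (1 + r) * r * (1 - p)))
      = f\<^sup>2 - g * (2 * (p - q) * (1 - r\<^sup>2)) * f\<^sup>2 + g * (p - q) * (1 + r) * (2 * f * (c * r))"
    unfolding pc by (simp add: power2_eq_square algebra_simps)
  also have "\<dots> \<le> f\<^sup>2 - g * (2 * (p - q) * (1 - r\<^sup>2)) * f\<^sup>2 + g * (p - q) * (1 + r) * (f\<^sup>2 + (c * r)\<^sup>2)"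
    using sum_squares_bound[of f "c * r"] g qp r by (intro add_left_mono mult_left_mono) auto
  finally show ?thesis
    by (simp add: algebra_simps power2_eq_square)
qed

lemma abs_square_odds_le:
  fixes y r :: real
  assumes "0 \<le> y" "y \<le> 1" "0 < r"
  shows "\<bar>((1 - y) / (y + r))\<^sup>2\<bar> \<le> (1 / r)\<^sup>2"
proof -
  have "0 \<le> (1 - y) / (y + r)" "(1 - y) / (y + r) \<le> 1 / r"
    using assms by (auto intro: frac_le)
  then have "((1 - y) / (y + r))\<^sup>2 \<le> (1 / r)\<^sup>2" by (intro power_mono)
  then show ?thesis by simp
qed

section \<open>First and second moments under a slowly vanishing penalty\<close>

locale slow_penalty_bandit = penalized_bandit +
  assumes \<rho>_lim: "\<rho> \<longlonglongrightarrow> 0"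
    and \<gamma>_\<rho>_lim: "(\<lambda>n. \<gamma> n / \<rho> n) \<longlonglongrightarrow> 0"
    and \<rho>_slow: "(\<lambda>n. \<rho> n - \<rho> (n - 1)) \<in> o(\<lambda>n. \<rho> n * \<gamma> n)"
begin

text \<open>The offset in the odds follows the current penalty, which is the expected scale of \<open>1 - X\<close>.\<close>

definition odds_moment :: "nat \<Rightarrow> real" where
  "odds_moment n = expectation (\<lambda>\<omega>. ((1 - X n \<omega>) / (X n \<omega> + \<rho> n))\<^sup>2) / (\<rho> n)\<^sup>2"

definition mean_ratio :: "nat \<Rightarrow> real" where
  "mean_ratio n = expectation (\<lambda>\<omega>. 1 - X n \<omega>) / \<rho> n"

lemma \<gamma>_lim: "\<gamma> \<longlonglongrightarrow> 0"
proof (rule Lim_transform_eventually)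
  show "(\<lambda>n. \<gamma> n / \<rho> n * \<rho> n) \<longlonglongrightarrow> 0"
    using tendsto_mult[OF \<gamma>_\<rho>_lim \<rho>_lim] by simp
  show "\<forall>\<^sub>F n in sequentially. \<gamma> n / \<rho> n * \<rho> n = \<gamma> n"
    using eventually_ge_at_top[of 1] by eventually_elim (use \<rho>_pos in force)
qed

lemma \<rho>_Suc_close:
  assumes "\<kappa> > 0"
  shows "\<forall>\<^sub>F n in sequentially. \<bar>\<rho> (Suc n) - \<rho> n\<bar> \<le> \<kappa> * (\<rho> (Suc n) * \<gamma> (Suc n))"
proof -
  have "\<forall>\<^sub>F n in sequentially. norm (\<rho> n - \<rho> (n - 1)) \<le> \<kappa> * norm (\<rho> n * \<gamma> n)"
    using landau_o.smallD[OF \<rho>_slow assms] .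
  then have "\<forall>\<^sub>F n in sequentially. norm (\<rho> (Suc n) - \<rho> (Suc n - 1)) \<le> \<kappa> * norm (\<rho> (Suc n) * \<gamma> (Suc n))"
    by (rule eventually_compose_filterlim[OF _ filterlim_Suc])
  then show ?thesis
  proof eventually_elim
    case (elim n)
    with \<rho>_pos[of "Suc n"] \<gamma>_pos[of "Suc n"] show ?case by (simp add: abs_mult)
  qed
qed

lemma integrable_square_odds:
  assumes r: "0 < r"
  shows "integrable M (\<lambda>\<omega>. ((1 - X n \<omega>) / (X n \<omega> + r))\<^sup>2)"
proof (rule integrable_const_bound[where B = "(1 / r)\<^sup>2"], rule AE_I2)
  show "norm (((1 - X n \<omega>) / (X n \<omega> + r))\<^sup>2) \<le> (1 / r)\<^sup>2" for \<omega>
    unfolding real_norm_def by (rule abs_square_odds_le[OF bandit_bounds r])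
qed measurable

lemma integrable_bandit: "integrable M (X n)"
  using bandit_bounds by (intro integrable_const_bound[where B = 1] AE_I2) auto

text \<open>
  Between two steps both the offset and the normalisation of the odds change from \<open>\<rho> n\<close> to
  \<open>\<rho> (Suc n)\<close>. With \<open>\<rho> n \<le> R \<rho> (Suc n)\<close> this multiplies the moment by at most \<open>R ^ 4\<close>, and
  \<open>R = 1 + o(\<gamma>)\<close>, so that the contraction of \<open>transition_square_odds_le\<close> survives.
\<close>

lemma odds_moment_Suc_le:
  assumes \<eta>: "0 < \<eta>" "\<eta> < p_A - p_B"
  defines "c \<equiv> (1 - p_A) / (p_A - p_B)"
  shows "\<forall>\<^sub>F n in sequentially. odds_moment (Suc n)
    \<le> (1 - (p_A - p_B - \<eta>) * \<gamma> (Suc n)) * odds_moment n + ((p_A - p_B) * c\<^sup>2 + \<eta>) * \<gamma> (Suc n)"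
proof -
  let ?\<pi> = "p_A - p_B"
  \<comment> \<open>\<open>(1 + \<kappa> g) ^ 4 \<le> 1 + 15 \<kappa> g\<close> may use half of the tolerance \<open>\<eta>\<close>; the other half absorbs the errors of the transition.\<close>
  define \<kappa> where "\<kappa> = \<eta> / 30"
  have \<pi>: "0 < ?\<pi>" "?\<pi> < 1" and \<eta>1: "\<eta> < 1" and \<kappa>: "0 < \<kappa>" "\<kappa> < 1"
    using p_B_pos p_B_less_p_A p_A_less_1 \<eta> by (auto simp: \<kappa>_def)
  have rate: "(\<lambda>n. ?\<pi> * (1 - \<rho> (Suc n) - 2 * (\<rho> (Suc n))\<^sup>2) - 156 * (\<gamma> (Suc n) / \<rho> (Suc n)))
      \<longlonglongrightarrow> ?\<pi> * (1 - 0 - 2 * 0\<^sup>2) - 156 * 0"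
    by (intro tendsto_intros LIMSEQ_Suc[OF \<rho>_lim] LIMSEQ_Suc[OF \<gamma>_\<rho>_lim])
  have source: "(\<lambda>n. ?\<pi> * c\<^sup>2 * (1 + \<rho> (Suc n)) + 156 * (\<gamma> (Suc n) / \<rho> (Suc n)))
      \<longlonglongrightarrow> ?\<pi> * c\<^sup>2 * (1 + 0) + 156 * 0"
    by (intro tendsto_intros LIMSEQ_Suc[OF \<rho>_lim] LIMSEQ_Suc[OF \<gamma>_\<rho>_lim])
  have "\<forall>\<^sub>F n in sequentially. ?\<pi> - \<eta> / 2
      < ?\<pi> * (1 - \<rho> (Suc n) - 2 * (\<rho> (Suc n))\<^sup>2) - 156 * (\<gamma> (Suc n) / \<rho> (Suc n))"
    using \<eta> by (intro order_tendstoD(1)[OF rate]) auto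
  moreover have "\<forall>\<^sub>F n in sequentially.
      ?\<pi> * c\<^sup>2 * (1 + \<rho> (Suc n)) + 156 * (\<gamma> (Suc n) / \<rho> (Suc n)) < ?\<pi> * c\<^sup>2 + \<eta>"
    using \<eta> by (intro order_tendstoD(2)[OF source]) auto
  moreover have "\<forall>\<^sub>F n in sequentially. \<rho> (Suc n) < 1"
    by (rule order_tendstoD(2)[OF LIMSEQ_Suc[OF \<rho>_lim]]) simp
  moreover have "\<forall>\<^sub>F n in sequentially. \<gamma> (Suc n) < 1 / 2"
    by (rule order_tendstoD(2)[OF LIMSEQ_Suc[OF \<gamma>_lim]]) simp
  ultimately show ?thesis
    using \<rho>_Suc_close[OF \<kappa>(1)] eventually_ge_at_top[of 1]
  proof eventually_elim
    case (elim n)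
    define r where "r = \<rho> (Suc n)"
    define g where "g = \<gamma> (Suc n)"
    define a where "a = ?\<pi> * (1 - r - 2 * r\<^sup>2) - 156 * g / r"
    define b where "b = ?\<pi> * c\<^sup>2 * (1 + r) + 156 * g / r"
    define R where "R = 1 + \<kappa> * g"
    define G where "G s \<omega> = ((1 - X n \<omega>) / (X n \<omega> + s))\<^sup>2" for s \<omega>
    have r: "0 < r" "r \<le> 1" and g: "0 < g" "g \<le> 1 / 2" and rn: "0 < \<rho> n"
      using elim \<rho>_pos \<gamma>_pos by (auto simp: r_def g_def)
    have a: "?\<pi> - \<eta> / 2 \<le> a" and b: "b \<le> ?\<pi> * c\<^sup>2 + \<eta>"
      using elim by (auto simp: a_def b_def r_def g_def)
    have "a \<le> ?\<pi> * (1 - r - 2 * r\<^sup>2)"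
      using g r by (simp add: a_def)
    also have "\<dots> \<le> ?\<pi> * 1"
      using \<pi> r zero_le_power2[of r] by (intro mult_left_mono) linarith+
    also have "\<dots> \<le> 1"
      using \<pi> by simp
    finally have "a \<le> 1" .
    moreover have "0 \<le> a"
      using a \<eta> by linarith
    ultimately have ga: "0 \<le> g * a" "0 \<le> 1 - g * a"
      using g mult_mono[of g 1 a 1] by auto
    have R1: "1 \<le> R" and \<kappa>g: "0 \<le> \<kappa> * g" "\<kappa> * g \<le> 1"
      using \<kappa> g mult_mono[of \<kappa> 1 g 1] by (auto simp: R_def)
    have "\<rho> n \<le> R * r"
      using elim(5) by (auto simp: R_def r_def g_def algebra_simps abs_le_iff)
    have G_le: "G r \<omega> / r\<^sup>2 \<le> R ^ 4 * (G (\<rho> n) \<omega> / (\<rho> n)\<^sup>2)" for \<omega>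
    proof -
      have x: "0 \<le> X n \<omega>" "X n \<omega> \<le> 1" by (rule bandit_bounds)+
      have "X n \<omega> + \<rho> n \<le> R * (X n \<omega> + r)"
        using \<open>\<rho> n \<le> R * r\<close> mult_right_mono[OF R1 x(1)] by (simp add: algebra_simps)
      then have "(X n \<omega> + \<rho> n) * \<rho> n \<le> (R * (X n \<omega> + r)) * (R * r)"
        using \<open>\<rho> n \<le> R * r\<close> x r rn R1 by (intro mult_mono) auto
      then have "(1 - X n \<omega>) / ((R * (X n \<omega> + r)) * (R * r)) \<le> (1 - X n \<omega>) / ((X n \<omega> + \<rho> n) * \<rho> n)"
        using x r rn R1 by (intro divide_left_mono mult_pos_pos) auto
      then have "R\<^sup>2 * ((1 - X n \<omega>) / ((R * (X n \<omega> + r)) * (R * r)))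
          \<le> R\<^sup>2 * ((1 - X n \<omega>) / ((X n \<omega> + \<rho> n) * \<rho> n))"
        by (intro mult_left_mono) auto
      also have "R\<^sup>2 * ((1 - X n \<omega>) / ((R * (X n \<omega> + r)) * (R * r))) = (1 - X n \<omega>) / ((X n \<omega> + r) * r)"
        using R1 by (simp add: power2_eq_square)
      finally have "(1 - X n \<omega>) / ((X n \<omega> + r) * r) \<le> R\<^sup>2 * ((1 - X n \<omega>) / ((X n \<omega> + \<rho> n) * \<rho> n))" .
      then have "((1 - X n \<omega>) / ((X n \<omega> + r) * r))\<^sup>2 \<le> (R\<^sup>2 * ((1 - X n \<omega>) / ((X n \<omega> + \<rho> n) * \<rho> n)))\<^sup>2"
        using x r by (intro power_mono) auto
      then show ?thesis
        by (simp add: G_def power_mult_distrib power_divide flip: power_mult)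
    qed
    have int: "integrable M (G s)" if "0 < s" for s
      unfolding G_def by (rule integrable_square_odds[OF that])
    have "expectation (\<lambda>\<omega>. ((1 - X (Suc n) \<omega>) / (X (Suc n) \<omega> + r))\<^sup>2)
        = expectation (\<lambda>\<omega>. transition p_A p_B g r (\<lambda>y. ((1 - y) / (y + r))\<^sup>2) (X n \<omega>))"
      unfolding r_def g_def
      by (rule expectation_transition[OF _ abs_square_odds_le]) (use r in \<open>simp_all add: r_def\<close>)
    also have "\<dots> \<le> expectation (\<lambda>\<omega>. (1 - g * a) * G r \<omega> + g * b * r\<^sup>2)"
    proof (rule integral_mono)
      show "integrable M (\<lambda>\<omega>. transition p_A p_B g r (\<lambda>y. ((1 - y) / (y + r))\<^sup>2) (X n \<omega>))"
        unfolding r_def g_def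
        by (rule integrable_transition[OF _ abs_square_odds_le]) (use r in \<open>simp_all add: r_def\<close>)
      show "transition p_A p_B g r (\<lambda>y. ((1 - y) / (y + r))\<^sup>2) (X n \<omega>)
          \<le> (1 - g * a) * G r \<omega> + g * b * r\<^sup>2" for \<omega>
        unfolding a_def b_def c_def G_def
        by (rule transition_square_odds_le[OF p_B_pos p_B_less_p_A p_A_less_1 bandit_bounds r g])
    qed (use int r in auto)
    also have "\<dots> = (1 - g * a) * expectation (G r) + g * b * r\<^sup>2"
      using int[OF r(1)] by (simp add: prob_space)
    finally have "odds_moment (Suc n) \<le> ((1 - g * a) * expectation (G r) + g * b * r\<^sup>2) / r\<^sup>2"
      unfolding odds_moment_def r_def by (intro divide_right_mono) auto
    also have "\<dots> = (1 - g * a) * expectation (\<lambda>\<omega>. G r \<omega> / r\<^sup>2) + g * b"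
      using r by (simp add: field_simps)
    also have "\<dots> \<le> (1 - g * a) * expectation (\<lambda>\<omega>. R ^ 4 * (G (\<rho> n) \<omega> / (\<rho> n)\<^sup>2)) + g * b"
      using G_le int r rn ga(2) by (intro add_right_mono mult_left_mono integral_mono) auto
    also have "\<dots> = (1 - g * a) * R ^ 4 * odds_moment n + g * b"
      by (simp add: odds_moment_def G_def)
    also have "\<dots> \<le> (1 - (?\<pi> - \<eta>) * g) * odds_moment n + (?\<pi> * c\<^sup>2 + \<eta>) * g"
    proof (intro add_mono mult_right_mono)
      have "R ^ 4 = 1 + \<kappa> * g * (4 + 6 * (\<kappa> * g) + 4 * (\<kappa> * g)\<^sup>2 + (\<kappa> * g) ^ 3)"
        unfolding R_def by algebra
      also have "\<dots> \<le> 1 + \<kappa> * g * (4 + 6 * 1 + 4 * 1 + 1)"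
        using \<kappa>g by (intro add_mono mult_left_mono order_refl power_le_one) auto
      finally have R4: "R ^ 4 \<le> 1 + 15 * (\<kappa> * g)" by simp
      have "(1 - g * a) * R ^ 4 \<le> (1 - g * a) * (1 + 15 * (\<kappa> * g))"
        using R4 ga(2) by (rule mult_left_mono)
      also have "\<dots> \<le> 1 - g * a + 15 * (\<kappa> * g)"
        using mult_nonneg_nonneg[OF ga(1) \<kappa>g(1)] by (simp add: algebra_simps)
      also have "\<dots> \<le> 1 - g * (?\<pi> - \<eta> / 2) + g * (\<eta> / 2)"
      proof -
        have "15 * (\<kappa> * g) = g * (\<eta> / 2)" by (simp add: \<kappa>_def)
        then show ?thesis
          using a g by (simp only:) (intro add_right_mono diff_left_mono mult_left_mono, auto)
      qed
      also have "\<dots> = 1 - (?\<pi> - \<eta>) * g"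
        by (simp add: algebra_simps)
      finally show "(1 - g * a) * R ^ 4 \<le> 1 - (?\<pi> - \<eta>) * g" .
      show "g * b \<le> (?\<pi> * c\<^sup>2 + \<eta>) * g"
        using mult_left_mono[OF b, of g] g by (simp add: mult.commute)
      show "0 \<le> odds_moment n"
        unfolding odds_moment_def by (intro divide_nonneg_nonneg Bochner_Integration.integral_nonneg) auto
    qed
    finally show ?case by (simp add: g_def)
  qed
qed

text \<open>
  For \<open>1 - X\<close> itself the transition is an explicit polynomial. The quadratic term of the
  reward part has the favourable sign, and replacing the penalty part by its value \<open>\<gamma> \<rho> (1 - p_A)\<close>
  at \<open>X = 1\<close> costs at most \<open>3 \<gamma> \<rho> (1 - X)\<close>.
\<close>

lemma mean_ratio_Suc_ge:
  assumes \<eta>: "0 < \<eta>"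
  shows "\<forall>\<^sub>F n in sequentially. mean_ratio (Suc n)
    \<ge> (1 - (p_A - p_B + \<eta>) * \<gamma> (Suc n)) * mean_ratio n + (1 - p_A) * \<gamma> (Suc n)"
proof -
  let ?\<pi> = "p_A - p_B"
  define \<kappa> where "\<kappa> = \<eta> / 2"
  have \<pi>: "0 < ?\<pi>" and \<kappa>: "0 < \<kappa>"
    using p_B_less_p_A \<eta> by (auto simp: \<kappa>_def)
  have "\<forall>\<^sub>F n in sequentially. \<rho> (Suc n) < \<eta> / 6"
    by (rule order_tendstoD(2)[OF LIMSEQ_Suc[OF \<rho>_lim]]) (use \<eta> in simp)
  moreover have "\<forall>\<^sub>F n in sequentially. \<gamma> (Suc n) < 1 / (?\<pi> + \<eta> / 2)"
    by (rule order_tendstoD(2)[OF LIMSEQ_Suc[OF \<gamma>_lim]]) (use \<eta> \<pi> in simp)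
  ultimately show ?thesis
    using \<rho>_Suc_close[OF \<kappa>] eventually_ge_at_top[of 1]
  proof eventually_elim
    case (elim n)
    define r where "r = \<rho> (Suc n)"
    define g where "g = \<gamma> (Suc n)"
    define d where "d = expectation (\<lambda>\<omega>. 1 - X n \<omega>)"
    have r: "0 < r" "3 * r \<le> \<eta> / 2" and g: "0 < g" and rn: "0 < \<rho> n"
      using elim \<rho>_pos \<gamma>_pos by (auto simp: r_def g_def)
    have d: "0 \<le> d" unfolding d_def by (rule Bochner_Integration.integral_nonneg) (simp add: bandit_bounds)
    have gk: "0 \<le> 1 - g * (?\<pi> + 3 * r)"
    proof -
      have "g * (?\<pi> + 3 * r) \<le> g * (?\<pi> + \<eta> / 2)" using r g by (intro mult_left_mono) auto
      also have "\<dots> \<le> 1" using elim(2) \<pi> \<eta> by (simp add: g_def pos_less_divide_eq)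
      finally show ?thesis by simp
    qed
    have pointwise: "transition p_A p_B g r (\<lambda>y. 1 - y) y \<ge> (1 - g * (?\<pi> + 3 * r)) * (1 - y) + g * r * (1 - p_A)"
      if y: "0 \<le> y" "y \<le> 1" for y
    proof -
      define e where "e = 1 - y"
      have e: "0 \<le> e" "e \<le> 1" "e\<^sup>2 \<le> e" using y by (auto simp: e_def power2_eq_square mult_left_le)
      have "(1 - p_A) * (1 - e)\<^sup>2 - (1 - p_B) * e\<^sup>2
          = (1 - p_A) - 2 * (1 - p_A) * e - (p_A - p_B) * e\<^sup>2"
        by (simp add: power2_eq_square algebra_simps)
      moreover have "2 * (1 - p_A) * e \<le> 2 * e"
        using p_B_pos p_B_less_p_A e by (intro mult_right_mono) auto
      moreover have "(p_A - p_B) * e\<^sup>2 \<le> 1 * e"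
        using e p_B_pos p_A_less_1 p_B_less_p_A by (intro mult_mono) auto
      ultimately have k: "(1 - p_A) * (1 - e)\<^sup>2 - (1 - p_B) * e\<^sup>2 \<ge> (1 - p_A) - 3 * e"
        by linarith
      have "g * ?\<pi> * e\<^sup>2 \<ge> 0" using g \<pi> by simp
      moreover have "g * r * ((1 - p_A) * (1 - e)\<^sup>2 - (1 - p_B) * e\<^sup>2) \<ge> g * r * ((1 - p_A) - 3 * e)"
        using k g r by (intro mult_left_mono) auto
      moreover have "transition p_A p_B g r (\<lambda>y. 1 - y) y
          = e - g * ?\<pi> * e + g * ?\<pi> * e\<^sup>2 + g * r * ((1 - p_A) * (1 - e)\<^sup>2 - (1 - p_B) * e\<^sup>2)"
        unfolding transition_def e_def by algebra
      ultimately have "transition p_A p_B g r (\<lambda>y. 1 - y) y \<ge> e - g * ?\<pi> * e + g * r * ((1 - p_A) - 3 * e)"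
        by linarith
      then show ?thesis by (simp add: e_def algebra_simps)
    qed
    have "(1 - g * (?\<pi> + 3 * r)) * d + g * r * (1 - p_A)
        = expectation (\<lambda>\<omega>. (1 - g * (?\<pi> + 3 * r)) * (1 - X n \<omega>) + g * r * (1 - p_A))"
      unfolding d_def using integrable_bandit by (simp add: prob_space)
    also have "\<dots> \<le> expectation (\<lambda>\<omega>. transition p_A p_B g r (\<lambda>y. 1 - y) (X n \<omega>))"
    proof (rule integral_mono)
      show "integrable M (\<lambda>\<omega>. transition p_A p_B g r (\<lambda>y. 1 - y) (X n \<omega>))"
        unfolding r_def g_def by (rule integrable_transition[where C = 1]) auto
    qed (use integrable_bandit pointwise bandit_bounds in auto)
    also have "\<dots> = expectation (\<lambda>\<omega>. 1 - X (Suc n) \<omega>)"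
      unfolding r_def g_def by (rule expectation_transition[where C = 1, symmetric]) auto
    finally have "((1 - g * (?\<pi> + 3 * r)) * d + g * r * (1 - p_A)) / r \<le> mean_ratio (Suc n)"
      unfolding mean_ratio_def r_def using r by (intro divide_right_mono) (auto simp: r_def)
    then have main: "(1 - g * (?\<pi> + 3 * r)) * (d / r) + g * (1 - p_A) \<le> mean_ratio (Suc n)"
      using r by (simp add: add_divide_distrib)
    have y: "0 \<le> mean_ratio n" "d = mean_ratio n * \<rho> n"
      using d rn by (auto simp: mean_ratio_def d_def)
    have "r * (1 - \<kappa> * g) \<le> \<rho> n"
      using elim(3) by (auto simp: r_def g_def algebra_simps abs_le_iff)
    then have "mean_ratio n * (r * (1 - \<kappa> * g)) \<le> d"
      using y by (simp add: mult_left_mono)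
    then have dr: "(1 - \<kappa> * g) * mean_ratio n \<le> d / r"
      using r by (simp add: pos_le_divide_eq mult_ac)
    have "(1 - (?\<pi> + \<eta>) * g) * mean_ratio n \<le> (1 - g * (?\<pi> + 3 * r)) * (1 - \<kappa> * g) * mean_ratio n"
    proof (rule mult_right_mono[OF _ y(1)])
      have "g * (3 * r) \<le> g * (\<eta> / 2)" using r g by (intro mult_left_mono) auto
      moreover have "0 \<le> g * (?\<pi> + 3 * r) * (\<kappa> * g)" using g \<pi> r \<kappa> by simp
      moreover have "(1 - g * (?\<pi> + 3 * r)) * (1 - \<kappa> * g)
          = 1 - (?\<pi> + \<eta>) * g + (g * (\<eta> / 2) - g * (3 * r)) + g * (?\<pi> + 3 * r) * (\<kappa> * g)"
        unfolding \<kappa>_def by (simp add: field_simps)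
      ultimately show "1 - (?\<pi> + \<eta>) * g \<le> (1 - g * (?\<pi> + 3 * r)) * (1 - \<kappa> * g)"
        by linarith
    qed
    also have "\<dots> \<le> (1 - g * (?\<pi> + 3 * r)) * (d / r)"
      unfolding mult.assoc using dr gk by (intro mult_left_mono) auto
    finally show ?case using main by (simp add: g_def mult.commute)
  qed
qed

lemma eventually_odds_moment_le:
  assumes \<epsilon>: "\<epsilon> > 0"
  defines "c \<equiv> (1 - p_A) / (p_A - p_B)"
  shows "\<forall>\<^sub>F n in sequentially. odds_moment n \<le> c\<^sup>2 + \<epsilon>"
proof -
  let ?\<pi> = "p_A - p_B"
  have \<pi>: "?\<pi> > 0" using p_B_less_p_A by simp
  have "((\<lambda>\<eta>. (?\<pi> * c\<^sup>2 + \<eta>) / (?\<pi> - \<eta>)) \<longlongrightarrow> (?\<pi> * c\<^sup>2 + 0) / (?\<pi> - 0)) (at_right 0)"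
    using \<pi> by (intro tendsto_intros) auto
  then have "\<forall>\<^sub>F \<eta> in at_right 0. (?\<pi> * c\<^sup>2 + \<eta>) / (?\<pi> - \<eta>) < c\<^sup>2 + \<epsilon> / 2"
    using \<epsilon> \<pi> by (intro order_tendstoD(2)) auto
  moreover have "\<forall>\<^sub>F \<eta> in at_right 0. \<eta> \<in> {0<..<?\<pi>}"
    using \<pi> by (rule eventually_at_right_real)
  ultimately obtain \<eta> where \<eta>: "0 < \<eta>" "\<eta> < ?\<pi>" "(?\<pi> * c\<^sup>2 + \<eta>) / (?\<pi> - \<eta>) < c\<^sup>2 + \<epsilon> / 2"
    using eventually_happens'[OF trivial_limit_at_right_real eventually_conj] 
    by (metis (no_types, lifting) greaterThanLessThan_iff)
  have "\<forall>\<^sub>F n in sequentially. odds_moment n \<le> (?\<pi> * c\<^sup>2 + \<eta>) / (?\<pi> - \<eta>) + \<epsilon> / 2"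
    using \<eta> \<epsilon> odds_moment_Suc_le[OF \<eta>(1,2)]
    by (intro limsup_le_of_contraction[OF _ \<gamma>_lim \<gamma>_sum]) (auto simp: c_def)
  then show ?thesis
    by eventually_elim (use \<eta>(3) in linarith)
qed

lemma eventually_mean_ratio_ge:
  assumes \<epsilon>: "\<epsilon> > 0"
  defines "c \<equiv> (1 - p_A) / (p_A - p_B)"
  shows "\<forall>\<^sub>F n in sequentially. mean_ratio n \<ge> c - \<epsilon>"
proof -
  let ?\<pi> = "p_A - p_B"
  have \<pi>: "?\<pi> > 0" using p_B_less_p_A by simp
  have "((\<lambda>\<eta>. (1 - p_A) / (?\<pi> + \<eta>)) \<longlongrightarrow> (1 - p_A) / (?\<pi> + 0)) (at_right 0)"
    using \<pi> by (intro tendsto_intros) auto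
  then have "\<forall>\<^sub>F \<eta> in at_right 0. c - \<epsilon> / 2 < (1 - p_A) / (?\<pi> + \<eta>)"
    using \<epsilon> \<pi> by (intro order_tendstoD(1)) (auto simp: c_def)
  moreover have "\<forall>\<^sub>F \<eta> in at_right 0. \<eta> \<in> {0<..<1::real}"
    by (rule eventually_at_right_real) simp
  ultimately obtain \<eta> where \<eta>: "0 < \<eta>" "c - \<epsilon> / 2 < (1 - p_A) / (?\<pi> + \<eta>)"
    using eventually_happens'[OF trivial_limit_at_right_real eventually_conj] 
    by (metis (no_types, lifting) greaterThanLessThan_iff)
  have "\<forall>\<^sub>F n in sequentially. - mean_ratio (Suc n)
      \<le> (1 - (?\<pi> + \<eta>) * \<gamma> (Suc n)) * (- mean_ratio n) + (- (1 - p_A)) * \<gamma> (Suc n)"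
    using mean_ratio_Suc_ge[OF \<eta>(1)] by eventually_elim (simp add: algebra_simps)
  then have "\<forall>\<^sub>F n in sequentially. - mean_ratio n \<le> - (1 - p_A) / (?\<pi> + \<eta>) + \<epsilon> / 2"
    using \<eta> \<epsilon> \<pi> by (intro limsup_le_of_contraction[OF _ \<gamma>_lim \<gamma>_sum]) auto
  then show ?thesis
    unfolding minus_divide_left[symmetric] by eventually_elim (use \<eta>(2) in linarith)
qed

text \<open>
  The bound \<open>1 - X \<le> (1 + \<rho>) (1 - X) / (X + \<rho>)\<close> passes from the odds back to \<open>1 - X\<close>.
\<close>

lemma second_moment_ratio_tendsto_0:
  defines "c \<equiv> (1 - p_A) / (p_A - p_B)"
  shows "(\<lambda>n. expectation (\<lambda>\<omega>. ((1 - X n \<omega>) / \<rho> n - c)\<^sup>2)) \<longlonglongrightarrow> 0"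
proof (rule order_tendstoI)
  fix e :: real assume "e < 0"
  then show "\<forall>\<^sub>F n in sequentially. e < expectation (\<lambda>\<omega>. ((1 - X n \<omega>) / \<rho> n - c)\<^sup>2)"
    by (intro always_eventually allI less_le_trans[OF _ Bochner_Integration.integral_nonneg]) auto
next
  fix e :: real assume e: "0 < e"
  have c: "0 < c" using p_B_less_p_A p_A_less_1 by (simp add: c_def)
  \<comment> \<open>The two moment bounds with tolerance \<open>\<epsilon>\<close> leave a second moment of at most \<open>\<epsilon> + 2 c \<epsilon>\<close>.\<close>
  define \<epsilon> where "\<epsilon> = e / 2 / (1 + 2 * c)"
  have half: "\<epsilon> * (1 + 2 * c) = e / 2"
    unfolding \<epsilon>_def using c by (metis add_pos_pos less_numeral_extra(1) less_numeral_extra(3) mult_pos_pos nonzero_eq_divide_eq zero_less_numeral)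
  have \<epsilon>: "0 < \<epsilon>" "\<epsilon> * (1 + 2 * c) < e"
    unfolding half using e c by (simp_all add: \<epsilon>_def)
  have "(\<lambda>n. (1 + \<rho> n)\<^sup>2 * (c\<^sup>2 + \<epsilon> / 2)) \<longlonglongrightarrow> (1 + 0)\<^sup>2 * (c\<^sup>2 + \<epsilon> / 2)"
    by (intro tendsto_intros \<rho>_lim)
  then have "\<forall>\<^sub>F n in sequentially. (1 + \<rho> n)\<^sup>2 * (c\<^sup>2 + \<epsilon> / 2) < c\<^sup>2 + \<epsilon>"
    using \<epsilon> by (intro order_tendstoD(2)) auto
  moreover have "\<forall>\<^sub>F n in sequentially. odds_moment n \<le> c\<^sup>2 + \<epsilon> / 2"
    unfolding c_def using \<epsilon> by (intro eventually_odds_moment_le) auto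
  moreover have "\<forall>\<^sub>F n in sequentially. mean_ratio n \<ge> c - \<epsilon>"
    unfolding c_def using \<epsilon> by (intro eventually_mean_ratio_ge) auto
  ultimately show "\<forall>\<^sub>F n in sequentially. expectation (\<lambda>\<omega>. ((1 - X n \<omega>) / \<rho> n - c)\<^sup>2) < e"
    using eventually_ge_at_top[of 1]
  proof eventually_elim
    case (elim n)
    define r where "r = \<rho> n"
    have r: "0 < r" using elim \<rho>_pos by (simp add: r_def)
    let ?f = "\<lambda>\<omega>. ((1 - X n \<omega>) / (X n \<omega> + r))\<^sup>2"
    have pointwise: "((1 - X n \<omega>) / r - c)\<^sup>2 \<le> ((1 + r)\<^sup>2 * (?f \<omega> / r\<^sup>2) - 2 * c * ((1 - X n \<omega>) / r)) + c\<^sup>2" for \<omega>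
    proof -
      have x: "0 \<le> X n \<omega>" "X n \<omega> \<le> 1" by (rule bandit_bounds)+
      have "(1 - X n \<omega>) * (X n \<omega> + r) \<le> (1 - X n \<omega>) * (1 + r)"
        using x by (intro mult_left_mono) auto
      then have "1 - X n \<omega> \<le> (1 - X n \<omega>) * (1 + r) / (X n \<omega> + r)"
        using x r by (simp add: pos_le_divide_eq)
      then have "(1 - X n \<omega>) / r \<le> (1 - X n \<omega>) * (1 + r) / (X n \<omega> + r) / r"
        using r by (intro divide_right_mono) auto
      then have "(1 - X n \<omega>) / r \<le> (1 + r) * ((1 - X n \<omega>) / (X n \<omega> + r) / r)"
        by (simp add: mult.commute)
      then have "((1 - X n \<omega>) / r)\<^sup>2 \<le> ((1 + r) * ((1 - X n \<omega>) / (X n \<omega> + r) / r))\<^sup>2"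
        using x r by (intro power_mono) auto
      also have "\<dots> = (1 + r)\<^sup>2 * (?f \<omega> / r\<^sup>2)"
        by (simp add: power_mult_distrib power_divide)
      finally show ?thesis by (simp add: power2_diff mult_ac)
    qed
    have ints: "integrable M ?f" "integrable M (X n)"
      using integrable_square_odds[OF r] integrable_bandit by auto
    have "expectation (\<lambda>\<omega>. ((1 - X n \<omega>) / r - c)\<^sup>2)
        \<le> expectation (\<lambda>\<omega>. ((1 + r)\<^sup>2 * (?f \<omega> / r\<^sup>2) - 2 * c * ((1 - X n \<omega>) / r)) + c\<^sup>2)"
      using pointwise ints by (intro integral_mono') (auto intro: order_trans[OF zero_le_power2])
    also have "\<dots> = (1 + r)\<^sup>2 * odds_moment n - 2 * c * mean_ratio n + c\<^sup>2"
      using ints by (simp add: odds_moment_def mean_ratio_def r_def prob_space)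
    also have "\<dots> \<le> (1 + r)\<^sup>2 * (c\<^sup>2 + \<epsilon> / 2) - 2 * c * (c - \<epsilon>) + c\<^sup>2"
      using elim c by (intro add_right_mono diff_mono mult_left_mono) auto
    also have "\<dots> \<le> (c\<^sup>2 + \<epsilon>) - 2 * c * (c - \<epsilon>) + c\<^sup>2"
      using elim(1) by (simp add: r_def)
    also have "\<dots> = \<epsilon> * (1 + 2 * c)"
      by (simp add: power2_eq_square algebra_simps)
    finally show ?case using \<epsilon>(2) by (simp add: r_def)
  qed
qed

lemma converges_in_probability_ratio:
  "converges_in_probability M (\<lambda>n \<omega>. (1 - X n \<omega>) / \<rho> n) (\<lambda>\<omega>. (1 - p_A) / (p_A - p_B))"
  unfolding converges_in_probability_def
proof (intro conjI allI impI)
  let ?c = "(1 - p_A) / (p_A - p_B)"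
  fix \<epsilon> :: real assume \<epsilon>: "0 < \<epsilon>"
  show "(\<lambda>n. prob {\<omega> \<in> space M. \<bar>(1 - X n \<omega>) / \<rho> n - ?c\<bar> > \<epsilon>}) \<longlonglongrightarrow> 0"
  proof (rule tendsto_sandwich[OF _ _ tendsto_const])
    show "(\<lambda>n. expectation (\<lambda>\<omega>. ((1 - X n \<omega>) / \<rho> n - ?c)\<^sup>2) / \<epsilon>\<^sup>2) \<longlonglongrightarrow> 0"
      using tendsto_divide[OF second_moment_ratio_tendsto_0 tendsto_const[of "\<epsilon>\<^sup>2"]] \<epsilon> by simp
    have "prob {\<omega> \<in> space M. \<bar>(1 - X n \<omega>) / \<rho> n - ?c\<bar> > \<epsilon>}
        \<le> expectation (\<lambda>\<omega>. ((1 - X n \<omega>) / \<rho> n - ?c)\<^sup>2) / \<epsilon>\<^sup>2" for n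
    proof -
      have "integrable M (\<lambda>\<omega>. ((1 - X n \<omega>) / \<rho> n - ?c)\<^sup>2)"
      proof (rule integrable_const_bound[where B = "(1 / \<bar>\<rho> n\<bar> + \<bar>?c\<bar>)\<^sup>2"], rule AE_I2)
        fix \<omega>
        have "\<bar>(1 - X n \<omega>) / \<rho> n - ?c\<bar> \<le> \<bar>(1 - X n \<omega>) / \<rho> n\<bar> + \<bar>?c\<bar>"
          by (rule abs_triangle_ineq4)
        also have "\<dots> \<le> 1 / \<bar>\<rho> n\<bar> + \<bar>?c\<bar>"
          unfolding abs_divide using bandit_bounds[of n \<omega>] by (intro add_right_mono divide_right_mono) auto
        finally show "norm (((1 - X n \<omega>) / \<rho> n - ?c)\<^sup>2) \<le> (1 / \<bar>\<rho> n\<bar> + \<bar>?c\<bar>)\<^sup>2"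
          by (simp add: abs_le_square_iff[symmetric])
      qed measurable
      then have "prob {\<omega> \<in> space M. \<bar>(1 - X n \<omega>) / \<rho> n - ?c\<bar> \<ge> \<epsilon>}
          \<le> expectation (\<lambda>\<omega>. ((1 - X n \<omega>) / \<rho> n - ?c)\<^sup>2) / \<epsilon>\<^sup>2"
        using \<epsilon> by (intro second_moment_method) auto
      moreover have "prob {\<omega> \<in> space M. \<bar>(1 - X n \<omega>) / \<rho> n - ?c\<bar> > \<epsilon>}
          \<le> prob {\<omega> \<in> space M. \<bar>(1 - X n \<omega>) / \<rho> n - ?c\<bar> \<ge> \<epsilon>}"
        by (intro finite_measure_mono) auto
      ultimately show ?thesis by linarith
    qed
    then show "\<forall>\<^sub>F n in sequentially. prob {\<omega> \<in> space M. \<bar>(1 - X n \<omega>) / \<rho> n - ?c\<bar> > \<epsilon>}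
        \<le> expectation (\<lambda>\<omega>. ((1 - X n \<omega>) / \<rho> n - ?c)\<^sup>2) / \<epsilon>\<^sup>2"
      by simp
  qed simp
qed measurable

end

theorem theorem2:
  fixes M :: "'a measure"
    and p_A p_B x :: real
    and \<gamma> \<rho> :: "nat \<Rightarrow> real"
    and U :: "nat \<Rightarrow> 'a \<Rightarrow> real"
    and A B :: "nat \<Rightarrow> 'a set"
  assumes "penalized_bandit M p_A p_B \<gamma> \<rho> U A B x"
    and "\<rho> \<longlonglongrightarrow> 0"
    and "(\<lambda>n. \<gamma> n / \<rho> n) \<longlonglongrightarrow> 0"
    and "filterlim (\<lambda>N. \<Sum>n=1..N. \<rho> n * \<gamma> n) at_top sequentially"
    and "(\<lambda>n. \<rho> n - \<rho> (n - 1)) \<in> o(\<lambda>n. \<rho> n * \<gamma> n)"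
  shows "converges_in_probability M
           (\<lambda>n \<omega>. (1 - bandit \<gamma> \<rho> U A B x n \<omega>) / \<rho> n)
           (\<lambda>\<omega>. (1 - p_A) / (p_A - p_B))"
proof -
  interpret penalized_bandit M p_A p_B \<gamma> \<rho> U A B x by fact
  interpret slow_penalty_bandit M p_A p_B \<gamma> \<rho> U A B x by unfold_locales fact+
  show ?thesis by (rule converges_in_probability_ratio)
qed

end
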